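(* For every convex body $K \subseteq \mathbb{R}^2$ of unit area, we have \[\lim_{n \to \infty} n^{-2}EH_{2,4}^K(n) = 10-\frac{2\pi^2}{3}.\]
   Context: A convex body in $\mathbb{R}^2$ is a compact convex subset of $\mathbb{R}^2$ with nonempty interior. A finite point set is in convex position if none of its points lies in the convex hull of the remaining points. A finite set $S\subseteq\mathbb{R}^2$ is in general position if no three of its points lie on a line. For an integer $k\ge 3$, a $k$-hole in a finite set $S\subseteq\mathbb{R}^2$ in general position is a set of $k$ points of $S$ in convex position whose convex hull contains no point of $S$ in its interior. For a convex body $K\subseteq\mathbb{R}^2$ of unit area, $EH^K_{2,k}(n)$ denotes the expected number of $k$-holes in a set of $n$ points chosen uniformly and independently at random from $K$ (such a set is in general position with probability $1$). *)

theory Defs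
  imports "HOL-Probability.Probability"
begin

definition convex_body :: "(real^2) set \<Rightarrow> bool" where
  "convex_body K \<longleftrightarrow> compact K \<and> convex K \<and> interior K \<noteq> {}"

definition convex_position :: "(real^2) set \<Rightarrow> bool" where
  "convex_position P \<longleftrightarrow> finite P \<and> (\<forall>p\<in>P. p \<notin> convex hull (P - {p}))"

definition general_position :: "(real^2) set \<Rightarrow> bool" where
  "general_position S \<longleftrightarrow> finite S \<and> (\<forall>T\<subseteq>S. card T = 3 \<longrightarrow> \<not> collinear T)"

(* Holes are only considered in sets in general position; a set that is not in
   general position has no holes here. This affects only a null set of samples. *)
definition hole :: "nat \<Rightarrow> (real^2) set \<Rightarrow> (real^2) set \<Rightarrow> bool" where
  "hole k S H \<longleftrightarrow>
     general_position S \<and> H \<subseteq> S \<and> card H = k \<and> convex_position H \<and>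
     interior (convex hull H) \<inter> S = {}"

(* A sample is a family x of n independent points, each uniformly distributed on K;
   the random point set is the image of x. Its n points are almost surely distinct. *)
definition expected_holes :: "nat \<Rightarrow> (real^2) set \<Rightarrow> nat \<Rightarrow> real" where
  "expected_holes k K n =
     (LINT x|(\<Pi>\<^sub>M i\<in>{..<n}. uniform_measure lborel K). real (card {H. hole k (x ` {..<n}) H}))"

end

theory Submission
  imports Defs
begin

text \<open>Order the vertices of a 4-hole by their first coordinate: \<open>p\<close> is leftmost, \<open>q\<close> rightmost and
  \<open>k\<close>, \<open>l\<close> lie between. Every 4-hole then has one normalised labelling \<open>(p, q, k, l)\<close>, and by
  independence the expected number of 4-holes is \<open>n (n - 1) (n - 2) (n - 3)\<close> times the integral over
  \<open>K\<^sup>4\<close> of \<open>(1 - A)\<^sup>n\<^sup>-\<^sup>4\<close>, where \<open>A\<close> is the area of the quadrilateral. Only quadrilaterals with \<open>k\<close>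
  and \<open>l\<close> at distance \<open>O(1/n)\<close> from the line \<open>pq\<close> contribute. Writing \<open>k\<close> as the point of the segment
  with parameter \<open>s\<close> plus a vertical shift proportional to \<open>v/n\<close>, and \<open>l\<close> likewise with \<open>t\<close>, \<open>w\<close>, turns
  \<open>n A\<close> into a piecewise linear function of \<open>v\<close>, \<open>w\<close> that depends neither on \<open>n\<close> nor on \<open>p\<close>, \<open>q\<close>. In the
  limit the constraints \<open>k \<in> K\<close>, \<open>l \<in> K\<close> disappear, which is why the answer does not depend on \<open>K\<close>:
  what remains is an exponential integral over a cone, equal to 1 if \<open>k\<close>, \<open>l\<close> are on opposite sides of
  \<open>pq\<close>, and to the integral of \<open>(t - s) / (t (1 - s))\<close> over \<open>0 < s < t < 1\<close>, which is \<open>2 - \<pi>\<^sup>2/6\<close>, for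
  each of the two sides otherwise.\<close>

section \<open>Orientation, triangles and holes\<close>

text \<open>The value is 4 * (1/2) * (1 + 2 (2 - pi^2/6)): \<open>k\<close> and \<open>l\<close>
  each bring a Jacobian 2/n, giving 4/n^2 against about n^4 index quadruples; 1/2 is the probability
  that \<open>p\<close> is left of \<open>q\<close>; the bracket is the cone integral. Ordering by
  one coordinate makes \<open>pq\<close> either a diagonal or a side, and it puts \<open>k\<close>
  and \<open>l\<close> over the open segment. Their limits on that segment are then interior points
  of \<open>K\<close>, by convexity, as soon as \<open>p\<close> and \<open>q\<close> are. The
  obstacle is exchanging limit and integral: the rescaled heights \<open>v\<close>, \<open>w\<close>
  are unbounded and \<open>p\<close>, \<open>q\<close> may be close together. The vertical scale of
  \<open>chart\<close> contains the horizontal distance of \<open>p\<close> and \<open>q\<close>, so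
  closeness does no harm. The bound simply ignores \<open>K\<close>: dropping the two memberships
  enlarges the integrand, and for at least 8 points the power is at most exp (-a/2), where a is the
  rescaled area. The cone integral at rate 1/2 therefore dominates, uniformly in \<open>p\<close>
  and \<open>q\<close>.\<close>

definition orient :: "real^2 \<Rightarrow> real^2 \<Rightarrow> real^2 \<Rightarrow> real" where
  "orient a b c = (b$1 - a$1) * (c$2 - a$2) - (b$2 - a$2) * (c$1 - a$1)"

text \<open>The open triangle for either orientation of its vertices; collinear vertices give the
  empty set.\<close>

definition in_triangle :: "real^2 \<Rightarrow> real^2 \<Rightarrow> real^2 \<Rightarrow> real^2 \<Rightarrow> bool" where
  "in_triangle a b c y \<longleftrightarrow>
     0 < orient a b y \<and> 0 < orient b c y \<and> 0 < orient c a y \<or>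
     orient a b y < 0 \<and> orient b c y < 0 \<and> orient c a y < 0"

lemma orient_rotate: "orient b c a = orient a b c"
  by (simp add: orient_def algebra_simps)

lemma orient_swap: "orient b a c = - orient a b c"
  by (simp add: orient_def algebra_simps)

lemma orient_swap2: "orient a c b = - orient a b c"
  by (simp add: orient_def algebra_simps)

lemma orient_refl [simp]: "orient a a c = 0" "orient a b a = 0" "orient a b b = 0"
  by (simp_all add: orient_def algebra_simps)

text \<open>Divided by the right-hand side, the three signed areas are the barycentric coordinates
  of \<open>y\<close>.\<close>

lemma orient_split: "orient a b y + orient b c y + orient c a y = orient a b c"
  by (simp add: orient_def algebra_simps)

lemma orient_affine:
  assumes "u + v + w = 1"
  shows "orient a b (u *\<^sub>R x + v *\<^sub>R y + w *\<^sub>R z) = u * orient a b x + v * orient a b y + w * orient a b z"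
proof -
  have u: "u = 1 - v - w" using assms by simp
  show ?thesis by (simp add: orient_def u algebra_simps)
qed

lemma collinear_orient: "collinear {a, b, c} \<longleftrightarrow> orient a b c = 0"
proof (cases "a = c")
  case False
  show ?thesis
  proof
    assume "collinear {a, b, c}"
    then obtain u where b: "b = u *\<^sub>R a + (1 - u) *\<^sub>R c"
      using False by (auto simp: collinear_3_expand)
    show "orient a b c = 0"
      unfolding b by (simp add: orient_def algebra_simps)
  next
    assume o: "orient a b c = 0"
    have "\<exists>u. b = u *\<^sub>R a + (1 - u) *\<^sub>R c"
    \<comment> \<open>The parameter is read off a coordinate in which \<open>a\<close> and
      \<open>c\<close> differ.\<close>
    proof (cases "a$1 = c$1")
      case True
      then have ne: "a$2 \<noteq> c$2" using False by (simp add: vec_eq_iff forall_2)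
      with o True have "b$1 = a$1" by (simp add: orient_def)
      then show ?thesis using True ne
        by (intro exI[of _ "(b$2 - c$2) / (a$2 - c$2)"])
           (simp add: vec_eq_iff forall_2 \<open>b$1 = a$1\<close>, simp add: divide_simps, simp add: algebra_simps)
    next
      case ne: False
      have "(b$1 - c$1) * (a$2 - c$2) = (b$2 - c$2) * (a$1 - c$1)"
        using o by (simp add: orient_def algebra_simps)
      then show ?thesis using ne
        by (intro exI[of _ "(b$1 - c$1) / (a$1 - c$1)"])
           (simp add: vec_eq_iff forall_2 ne, simp add: divide_simps ne, simp add: algebra_simps)
    qed
    then show "collinear {a, b, c}" by (auto simp: collinear_3_expand)
  qed
qed (simp add: insert_commute)

lemma in_triangle_subset_hull:
  assumes "in_triangle a b c y"
  shows "y \<in> convex hull {a, b, c}"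
proof -
  let ?D = "orient a b c"
  have D: "orient a b y + orient b c y + orient c a y = ?D" by (rule orient_split)
  have nz: "?D \<noteq> 0" using assms D by (auto simp: in_triangle_def)
  let ?u = "orient b c y / ?D" and ?v = "orient c a y / ?D" and ?w = "orient a b y / ?D"
  have pos: "?u \<ge> 0 \<and> ?v \<ge> 0 \<and> ?w \<ge> 0"
    using assms D by (auto simp: in_triangle_def divide_simps)
  have sum: "?u + ?v + ?w = 1"
    using D nz by (simp add: field_simps)
  \<comment> \<open>Cramer's rule, cleared of its denominator to become a polynomial
    identity.\<close>
  have "?D *\<^sub>R y = orient b c y *\<^sub>R a + orient c a y *\<^sub>R b + orient a b y *\<^sub>R c"
    by (simp add: vec_eq_iff forall_2 orient_def algebra_simps)
  then have "y = (1 / ?D) *\<^sub>R (orient b c y *\<^sub>R a + orient c a y *\<^sub>R b + orient a b y *\<^sub>R c)"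
    using nz by (simp flip: \<open>?D *\<^sub>R y = _\<close>)
  also have "\<dots> = ?u *\<^sub>R a + ?v *\<^sub>R b + ?w *\<^sub>R c"
    by (simp add: scaleR_add_right)
  finally show ?thesis
    using pos sum unfolding convex_hull_3 by blast
qed

lemma continuous_on_orient [continuous_intros]:
  "continuous_on A f \<Longrightarrow> continuous_on A g \<Longrightarrow> continuous_on A h \<Longrightarrow>
    continuous_on A (\<lambda>x. orient (f x) (g x) (h x))"
  unfolding orient_def by (intro continuous_intros)

lemma open_in_triangle: "open {y. in_triangle a b c y}"
  unfolding in_triangle_def
  by (intro open_Collect_disj open_Collect_conj open_Collect_less continuous_intros)

text \<open>Converse away from the three side lines: each \<open>orient\<close> value is a convex
  weight times \<open>orient a b c\<close>, so if none vanishes, all weights are positive. General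
  position supplies these hypotheses for sample points.\<close>

lemma hull_imp_in_triangle:
  assumes y: "y \<in> convex hull {a, b, c}"
    and nz: "orient a b y \<noteq> 0" "orient b c y \<noteq> 0" "orient c a y \<noteq> 0"
  shows "in_triangle a b c y"
proof -
  obtain u v w where uvw: "0 \<le> u" "0 \<le> v" "0 \<le> w" "u + v + w = 1"
    and y: "y = u *\<^sub>R a + v *\<^sub>R b + w *\<^sub>R c"
    using y unfolding convex_hull_3 by blast
  have 1: "orient a b y = w * orient a b c"
    by (simp add: y orient_affine[OF uvw(4)])
  have 2: "orient b c y = u * orient a b c"
    by (simp add: y orient_affine[OF uvw(4)] orient_rotate)
  have 3: "orient c a y = v * orient a b c"
    by (simp add: y orient_affine[OF uvw(4)] orient_rotate)
  from 1 2 3 nz uvw have "0 < u" "0 < v" "0 < w" by auto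
  with nz 1 show ?thesis
    unfolding in_triangle_def 1 2 3
    by (cases "0 < orient a b c") (auto simp: mult_less_0_iff zero_less_mult_iff)
qed

section \<open>Quadrilaterals with crossing diagonals\<close>

lemma convex_hull_4_weights:
  assumes "y \<in> convex hull {a, b, c, d}"
  obtains \<alpha> \<beta> \<gamma> \<delta> where "0 \<le> \<alpha>" "0 \<le> \<beta>" "0 \<le> \<gamma>" "0 \<le> \<delta>" "\<alpha> + \<beta> + \<gamma> + \<delta> = 1"
    "y = \<alpha> *\<^sub>R a + \<beta> *\<^sub>R b + \<gamma> *\<^sub>R c + \<delta> *\<^sub>R d"
proof -
  obtain u v z where uv: "0 \<le> u" "0 \<le> v" "u + v = 1" "z \<in> convex hull {b, c, d}" "y = u *\<^sub>R a + v *\<^sub>R z"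
    using assms by (auto simp: convex_hull_insert[of "{b, c, d}"])
  then obtain p q r where pqr: "0 \<le> p" "0 \<le> q" "0 \<le> r" "p + q + r = 1" "z = p *\<^sub>R b + q *\<^sub>R c + r *\<^sub>R d"
    unfolding convex_hull_3 by blast
  have "u + v * p + v * q + v * r = 1"
    using pqr(4) uv(3) by (metis (no_types, lifting) add.assoc distrib_left mult.right_neutral)
  then show thesis
    using uv pqr by (intro that[of u "v * p" "v * q" "v * r"]) (auto simp: algebra_simps)
qed

text \<open>The arguments list the two diagonals \<open>ac\<close> and \<open>bd\<close>; the cyclic
  order of the vertices is \<open>a\<close>, \<open>b\<close>, \<open>c\<close>,
  \<open>d\<close>.\<close>

definition crossing :: "real^2 \<Rightarrow> real^2 \<Rightarrow> real^2 \<Rightarrow> real^2 \<Rightarrow> bool" where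
  "crossing a c b d \<longleftrightarrow> orient a c b * orient a c d < 0 \<and> orient b d a * orient b d c < 0"

text \<open>The affine function \<open>orient b d\<close> vanishes at \<open>b\<close> and
  \<open>d\<close>. On the triangle \<open>bcd\<close> it never has the sign opposite to its value
  at \<open>c\<close>, but at \<open>a\<close> it does.\<close>

lemma crossing_notin_hull:
  assumes "crossing a c b d"
  shows "a \<notin> convex hull {b, c, d}"
proof
  assume "a \<in> convex hull {b, c, d}"
  then obtain u v w where uvw: "0 \<le> u" "0 \<le> v" "0 \<le> w" "u + v + w = 1"
    and a: "a = u *\<^sub>R b + v *\<^sub>R c + w *\<^sub>R d"
    unfolding convex_hull_3 by blast
  have "orient b d a = v * orient b d c"
    by (subst a) (simp add: orient_affine[OF uvw(4)])
  with assms have "v * orient b d c ^ 2 < 0"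
    by (simp add: crossing_def power2_eq_square mult_ac)
  with uvw show False by (meson mult_nonneg_nonneg not_less zero_le_power2)
qed

lemma crossing_sym:
  assumes "crossing a c b d"
  shows "crossing c a b d" "crossing b d a c" "crossing d b a c"
  using assms unfolding crossing_def
  by (auto simp: orient_swap[of c a] orient_swap[of d b] mult_ac)

lemma crossing_convex_position:
  assumes "crossing a c b d"
  shows "convex_position {a, b, c, d}"
proof -
  have *: "p \<notin> convex hull ({a, b, c, d} - {p})"
    if "crossing p p' q r" "{a, b, c, d} = {p, q, p', r}" for p p' q r
  proof -
    have "{a, b, c, d} - {p} \<subseteq> {q, p', r}" using that(2) by blast
    then show ?thesis using crossing_notin_hull[OF that(1)] by (meson hull_mono in_mono)
  qed
  show ?thesis
    unfolding convex_position_def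
  proof (intro conjI ballI)
    fix p assume "p \<in> {a, b, c, d}"
    then consider "p = a" | "p = b" | "p = c" | "p = d" by blast
    then show "p \<notin> convex hull ({a, b, c, d} - {p})"
    proof cases
      case 1 show ?thesis unfolding 1 by (rule *[OF assms]) simp
    next
      case 2 show ?thesis unfolding 2 by (rule *[OF crossing_sym(2)[OF assms]]) (simp add: insert_commute)
    next
      case 3 show ?thesis unfolding 3 by (rule *[OF crossing_sym(1)[OF assms]]) (simp add: insert_commute)
    next
      case 4 show ?thesis unfolding 4 by (rule *[OF crossing_sym(3)[OF assms]]) (simp add: insert_commute)
    qed
  qed simp
qed

text \<open>The affine dependence between the four points has weights of alternating sign, so it can be
  subtracted from a convex combination until the weight of \<open>b\<close> or of \<open>d\<close> vanishes.\<close>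

lemma crossing_hull_subset:
  assumes "crossing a c b d"
  shows "convex hull {a, b, c, d} \<subseteq> convex hull {a, b, c} \<union> convex hull {a, c, d}"
proof
  fix y assume "y \<in> convex hull {a, b, c, d}"
  then obtain \<alpha> \<beta> \<gamma> \<delta> where w: "0 \<le> \<alpha>" "0 \<le> \<beta>" "0 \<le> \<gamma>" "0 \<le> \<delta>" "\<alpha> + \<beta> + \<gamma> + \<delta> = 1"
    and y: "y = \<alpha> *\<^sub>R a + \<beta> *\<^sub>R b + \<gamma> *\<^sub>R c + \<delta> *\<^sub>R d"
    by (rule convex_hull_4_weights)
  have "\<exists>A B C D. A > 0 \<and> C > 0 \<and> B > 0 \<and> D > 0 \<and> A + C = B + D \<and>
     A *\<^sub>R a + C *\<^sub>R c = B *\<^sub>R b + D *\<^sub>R d"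
  proof -
    \<comment> \<open>The coefficient of each point is the signed area of the other three; crossing
      makes all four signs equal.\<close>
    let ?A = "orient b c d" and ?B = "orient a c d" and ?C = "orient a b d" and ?D = "orient a b c"
    have dep: "?A *\<^sub>R a + ?C *\<^sub>R c = ?B *\<^sub>R b + ?D *\<^sub>R d" "?A + ?C = ?B + ?D"
      by (simp_all add: vec_eq_iff forall_2 orient_def algebra_simps)
    have "?B * ?D > 0" "?A * ?C > 0"
      using assms unfolding crossing_def
      by (simp_all add: orient_swap2[of a c b] orient_rotate[of b d a] orient_swap2[of b d c] mult.commute)
    then consider "?A > 0" "?C > 0" "?B > 0" "?D > 0" | "?A < 0" "?C < 0" "?B < 0" "?D < 0"
      using dep(2) by (auto simp: zero_less_mult_iff)
    then show ?thesis
    proof cases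
      case 1 with dep show ?thesis by blast
    next
      case 2
      have "(- ?A) *\<^sub>R a + (- ?C) *\<^sub>R c = (- ?B) *\<^sub>R b + (- ?D) *\<^sub>R d"
        using dep(1) by (metis (no_types, lifting) add_uminus_conv_diff minus_add_distrib scaleR_minus_left)
      then show ?thesis using 2 dep(2)
        by (intro exI[of _ "- ?A"] exI[of _ "- ?B"] exI[of _ "- ?C"] exI[of _ "- ?D"]) auto
    qed
  qed
  then obtain A B C D where pos: "A > 0" "C > 0" "B > 0" "D > 0" and s: "A + C = B + D"
    and dep: "A *\<^sub>R a + C *\<^sub>R c = B *\<^sub>R b + D *\<^sub>R d" by blast
  have yt: "y = (\<alpha> + t * A) *\<^sub>R a + (\<beta> - t * B) *\<^sub>R b + (\<gamma> + t * C) *\<^sub>R c + (\<delta> - t * D) *\<^sub>R d" for t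
  proof -
    have "t *\<^sub>R (A *\<^sub>R a + C *\<^sub>R c) = t *\<^sub>R (B *\<^sub>R b + D *\<^sub>R d)" by (simp add: dep)
    then show ?thesis by (simp add: y algebra_simps)
  qed
  have st: "(\<alpha> + t * A) + (\<beta> - t * B) + (\<gamma> + t * C) + (\<delta> - t * D) = 1" for t
  proof -
    have "t * (A + C) = t * (B + D)" by (simp add: s)
    then show ?thesis using w(5) by (simp add: algebra_simps)
  qed
  show "y \<in> convex hull {a, b, c} \<union> convex hull {a, c, d}"
  \<comment> \<open>The step \<open>t\<close> is the smaller ratio, so one weight vanishes while the
    other stays nonnegative; the weights of \<open>a\<close> and \<open>c\<close> only grow.\<close>
  proof (cases "\<beta> / B \<le> \<delta> / D")
    case True
    define t where "t = \<beta> / B"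
    have t: "t \<ge> 0" "\<beta> - t * B = 0" using pos w by (simp_all add: t_def)
    have "t * D \<le> \<delta>" using True pos by (simp add: t_def pos_le_divide_eq)
    moreover have "y = (\<alpha> + t * A) *\<^sub>R a + (\<gamma> + t * C) *\<^sub>R c + (\<delta> - t * D) *\<^sub>R d"
      using yt[of t] unfolding t(2) by (simp only: scaleR_zero_left add_0_right)
    moreover have "(\<alpha> + t * A) + (\<gamma> + t * C) + (\<delta> - t * D) = 1"
      using st[of t] unfolding t(2) by simp
    moreover have "0 \<le> \<alpha> + t * A" "0 \<le> \<gamma> + t * C" using pos w t by simp_all
    ultimately have "y \<in> convex hull {a, c, d}"
      unfolding convex_hull_3 by (metis (mono_tags, lifting) diff_ge_0_iff_ge mem_Collect_eq)
    then show ?thesis by simp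
  next
    case False
    define t where "t = \<delta> / D"
    have t: "t \<ge> 0" "\<delta> - t * D = 0" using pos w by (simp_all add: t_def)
    have "t * B \<le> \<beta>" using False pos by (simp add: t_def field_simps)
    moreover have "y = (\<alpha> + t * A) *\<^sub>R a + (\<beta> - t * B) *\<^sub>R b + (\<gamma> + t * C) *\<^sub>R c"
      using yt[of t] unfolding t(2) by (simp only: scaleR_zero_left add_0_right)
    moreover have "(\<alpha> + t * A) + (\<beta> - t * B) + (\<gamma> + t * C) = 1"
      using st[of t] unfolding t(2) by simp
    moreover have "0 \<le> \<alpha> + t * A" "0 \<le> \<gamma> + t * C" using pos w t by simp_all
    ultimately have "y \<in> convex hull {a, b, c}"
      unfolding convex_hull_3 by (metis (mono_tags, lifting) diff_ge_0_iff_ge mem_Collect_eq)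
    then show ?thesis by simp
  qed
qed

section \<open>Holes described by open triangles\<close>

lemma general_position_iff:
  "general_position S \<longleftrightarrow> finite S \<and>
    (\<forall>a\<in>S. \<forall>b\<in>S. \<forall>c\<in>S. a \<noteq> b \<longrightarrow> b \<noteq> c \<longrightarrow> a \<noteq> c \<longrightarrow> orient a b c \<noteq> 0)"
  unfolding general_position_def
proof (intro conj_cong refl iffI ballI impI allI)
  fix a b c assume "\<forall>T\<subseteq>S. card T = 3 \<longrightarrow> \<not> collinear T"
    and "a \<in> S" "b \<in> S" "c \<in> S" "a \<noteq> b" "b \<noteq> c" "a \<noteq> c"
  then have "\<not> collinear {a, b, c}" by (elim allE[of _ "{a, b, c}"]) auto
  then show "orient a b c \<noteq> 0" by (simp add: collinear_orient)
next
  fix T assume *: "\<forall>a\<in>S. \<forall>b\<in>S. \<forall>c\<in>S. a \<noteq> b \<longrightarrow> b \<noteq> c \<longrightarrow> a \<noteq> c \<longrightarrow> orient a b c \<noteq> 0"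
    and "T \<subseteq> S" "card T = 3"
  then show "\<not> collinear T" by (auto simp: card_3_iff collinear_orient)
qed

text \<open>Points in convex position are extreme points of their hull, and an extreme point is
  never interior.\<close>

lemma convex_position_interior:
  assumes "convex_position H"
  shows "interior (convex hull H) \<inter> H = {}"
proof -
  have "p extreme_point_of (convex hull H)" if "p \<in> H" for p
    using assms that extreme_point_of_convex_hull_convex_independent[OF finite_imp_compact, of H]
    unfolding convex_position_def by blast
  then show ?thesis using extreme_point_not_in_interior by blast
qed

text \<open>One condition does two jobs: points \<open>y\<close> of \<open>H\<close> account for
  convex position, the other points of \<open>S\<close> for emptiness. Unlike hulls and interiors,
  it is a finite combination of polynomial inequalities, from which measurability follows.\<close>

lemma hole_4_iff:
  "hole 4 S H \<longleftrightarrow> general_position S \<and> H \<subseteq> S \<and> card H = 4 \<and>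
     (\<forall>a\<in>H. \<forall>b\<in>H. \<forall>c\<in>H. \<forall>y\<in>S. \<not> in_triangle a b c y)"
proof (cases "general_position S \<and> H \<subseteq> S \<and> card H = 4")
  case True
  then have gp: "general_position S" and HS: "H \<subseteq> S" and card: "card H = 4" by auto
  have fin: "finite H" using card by (metis card.infinite zero_neq_numeral)
  have gpD: "orient a b c \<noteq> 0" if "a \<in> S" "b \<in> S" "c \<in> S" "a \<noteq> b" "b \<noteq> c" "a \<noteq> c" for a b c
    using gp that by (auto simp: general_position_iff)
  have inT: "in_triangle a b c y" if "y \<in> convex hull {a, b, c}" "y \<in> S" "y \<notin> {a, b, c}"
      "{a, b, c} \<subseteq> S" "a \<noteq> b" "b \<noteq> c" "a \<noteq> c" for a b c y
    using that(1) by (rule hull_imp_in_triangle) (rule gpD; use that(2-) in auto)+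
  have "convex_position H \<and> interior (convex hull H) \<inter> S = {} \<longleftrightarrow>
     (\<forall>a\<in>H. \<forall>b\<in>H. \<forall>c\<in>H. \<forall>y\<in>S. \<not> in_triangle a b c y)" (is "?L \<longleftrightarrow> ?R")
  proof
    assume L: ?L
    show ?R
    proof (intro ballI notI)
      fix a b c y assume *: "a \<in> H" "b \<in> H" "c \<in> H" "y \<in> S" "in_triangle a b c y"
      have "{y. in_triangle a b c y} \<subseteq> convex hull {a, b, c}"
        by (auto dest: in_triangle_subset_hull)
      also have "\<dots> \<subseteq> convex hull H" using * by (intro hull_mono) auto
      finally have "{y. in_triangle a b c y} \<subseteq> interior (convex hull H)"
        by (rule interior_maximal[OF _ open_in_triangle])
      then show False using L *(4,5) by blast
    qed
  next
    assume R: ?R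
    have conv: "convex_position H"
      unfolding convex_position_def
    proof (intro conjI fin ballI notI)
      fix p assume p: "p \<in> H" "p \<in> convex hull (H - {p})"
      have "card (H - {p}) = 3" using card p fin by simp
      then obtain a b c where abc: "H - {p} = {a, b, c}" "a \<noteq> b" "b \<noteq> c" "a \<noteq> c"
        by (auto simp: card_3_iff)
      then have "in_triangle a b c p" using p HS by (intro inT) auto
      moreover have "a \<in> H" "b \<in> H" "c \<in> H" "p \<in> S" using abc(1) p(1) HS by auto
      ultimately show False using R by blast
    qed
    moreover have "interior (convex hull H) \<inter> S = {}"
    proof (rule ccontr)
      assume "interior (convex hull H) \<inter> S \<noteq> {}"
      then obtain y where y: "y \<in> interior (convex hull H)" "y \<in> S" by blast
      show False
      proof (cases "y \<in> H")
        case True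
        with y show False using convex_position_interior[OF conv] by blast
      next
        case False
        have "y \<in> convex hull H" using y interior_subset by blast
        then have "\<exists>T. finite T \<and> T \<subseteq> H \<and> card T \<le> DIM(real^2) + 1 \<and> y \<in> convex hull T"
          by (subst (asm) caratheodory) (rule CollectD)
        then obtain T where T: "finite T" "T \<subseteq> H" "card T \<le> 3" "y \<in> convex hull T"
          by auto
        \<comment> \<open>The set from Caratheodory's theorem may have fewer than three points and
          is padded inside \<open>H\<close> to a genuine triangle.\<close>
        have "3 \<le> card H" using card by simp
        then obtain T' where T': "T \<subseteq> T'" "T' \<subseteq> H" "card T' = 3"
          using exists_subset_between[OF T(3) _ T(2) fin] by blast
        then obtain a b c where abc: "T' = {a, b, c}" "a \<noteq> b" "b \<noteq> c" "a \<noteq> c"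
          by (auto simp: card_3_iff)
        have "y \<in> convex hull {a, b, c}" using T(4) hull_mono[OF T'(1)] abc by auto
        then have "in_triangle a b c y" using abc T' HS y False by (intro inT) auto
        moreover have "a \<in> H" "b \<in> H" "c \<in> H" using abc T' by auto
        ultimately show False using R y(2) by blast
      qed
    qed
    ultimately show ?L by blast
  qed
  moreover have "hole 4 S H \<longleftrightarrow> ?L" by (simp add: hole_def gp HS card)
  ultimately show ?thesis by (simp only: gp HS card simp_thms)
next
  case False
  then show ?thesis unfolding hole_def by blast
qed

section \<open>Normalised quadrilaterals\<close>

text \<open>In \<open>same_quad\<close> both turns of the chain \<open>p\<close>, \<open>k\<close>, \<open>l\<close>, \<open>q\<close> have the same sign, so \<open>k\<close> and \<open>l\<close> lie on
  the same side of \<open>pq\<close>; both sides are covered.\<close>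

definition opposite_quad :: "real^2 \<Rightarrow> real^2 \<Rightarrow> real^2 \<Rightarrow> real^2 \<Rightarrow> bool" where
  "opposite_quad p q k l \<longleftrightarrow> p$1 < k$1 \<and> k$1 < q$1 \<and> p$1 < l$1 \<and> l$1 < q$1 \<and>
     orient p q l < 0 \<and> 0 < orient p q k"

definition same_quad :: "real^2 \<Rightarrow> real^2 \<Rightarrow> real^2 \<Rightarrow> real^2 \<Rightarrow> bool" where
  "same_quad p q k l \<longleftrightarrow> p$1 < k$1 \<and> k$1 < l$1 \<and> l$1 < q$1 \<and> 0 < orient p k l * orient k l q"

definition quad :: "real^2 \<Rightarrow> real^2 \<Rightarrow> real^2 \<Rightarrow> real^2 \<Rightarrow> bool" where
  "quad p q k l \<longleftrightarrow> opposite_quad p q k l \<or> same_quad p q k l"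

text \<open>The two open triangles cut off by a diagonal (\<open>pq\<close> or \<open>pl\<close>). The open diagonal itself is missing,
  which is harmless in general position.\<close>

definition quad_region :: "real^2 \<Rightarrow> real^2 \<Rightarrow> real^2 \<Rightarrow> real^2 \<Rightarrow> real^2 \<Rightarrow> bool" where
  "quad_region p q k l y \<longleftrightarrow>
     (if opposite_quad p q k l then in_triangle p q k y \<or> in_triangle p q l y
      else in_triangle p l k y \<or> in_triangle p l q y)"

definition quad_area :: "real^2 \<Rightarrow> real^2 \<Rightarrow> real^2 \<Rightarrow> real^2 \<Rightarrow> real" where
  "quad_area p q k l =
     (if opposite_quad p q k l then \<bar>orient p q k\<bar> + \<bar>orient p q l\<bar>
      else \<bar>orient p l k\<bar> + \<bar>orient p l q\<bar>) / 2"

text \<open>For points sorted by first coordinate the coefficients are positive, so signs can be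
  transferred: the first two identities go from the turns of a chain to its diagonals, the last two
  from the sides of \<open>pq\<close> to the turns.\<close>

lemma orient_chain:
  "(l$1 - k$1) * orient p l q = (l$1 - p$1) * orient k l q + (q$1 - l$1) * orient p k l"
  "(l$1 - k$1) * orient p k q = (q$1 - k$1) * orient p k l + (k$1 - p$1) * orient k l q"
  "(q$1 - p$1) * orient p k l = (k$1 - p$1) * orient p q l - (l$1 - p$1) * orient p q k"
  "(q$1 - p$1) * orient k l q = (q$1 - l$1) * orient p q k - (q$1 - k$1) * orient p q l"
  by (simp_all add: orient_def algebra_simps)

lemma pos_of_scaled: "0 < (c::real) \<Longrightarrow> 0 < c * x \<Longrightarrow> 0 < x"
  by (simp add: zero_less_mult_iff)

lemma neg_of_scaled: "0 < (c::real) \<Longrightarrow> c * x < 0 \<Longrightarrow> x < 0"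
  by (simp add: mult_less_0_iff)

text \<open>That \<open>pq\<close> separates \<open>k\<close> from \<open>l\<close> is part of the
  definition. That \<open>kl\<close> separates \<open>p\<close> from \<open>q\<close> holds because
  both middle points lie strictly between \<open>p\<close> and \<open>q\<close> in the first
  coordinate.\<close>

lemma opposite_quad_crossing:
  assumes "opposite_quad p q k l"
  shows "crossing p q k l"
proof -
  have *: "p$1 < k$1" "k$1 < q$1" "p$1 < l$1" "l$1 < q$1" "orient p q l < 0" "0 < orient p q k"
    using assms by (auto simp: opposite_quad_def)
  have c: "0 < k$1 - p$1" "0 < l$1 - p$1" "0 < q$1 - k$1" "0 < q$1 - l$1" "0 < q$1 - p$1"
    using * by auto
  have "(q$1 - p$1) * orient p k l < 0"
    using mult_pos_neg[OF c(1) *(5)] mult_pos_pos[OF c(2) *(6)]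
    by (simp only: orient_chain(3)[of q p k l])
  then have 1: "orient p k l < 0" by (rule neg_of_scaled[OF c(5)])
  have "0 < (q$1 - p$1) * orient k l q"
    using mult_pos_neg[OF c(3) *(5)] mult_pos_pos[OF c(4) *(6)]
    by (simp only: orient_chain(4)[of q p k l])
  then have 2: "0 < orient k l q" by (rule pos_of_scaled[OF c(5)])
  show ?thesis
    using * 1 2 unfolding crossing_def by (simp add: mult_pos_neg mult_neg_pos orient_rotate[of k l p])
qed

lemma same_quad_signs:
  assumes "same_quad p q k l"
  obtains "0 < orient p k l" "0 < orient k l q" "0 < orient p l q" "0 < orient p k q"
  | "orient p k l < 0" "orient k l q < 0" "orient p l q < 0" "orient p k q < 0"
proof -
  have *: "p$1 < k$1" "k$1 < l$1" "l$1 < q$1" "0 < orient p k l * orient k l q"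
    using assms by (auto simp: same_quad_def)
  have c: "0 < l$1 - p$1" "0 < q$1 - l$1" "0 < q$1 - k$1" "0 < k$1 - p$1" "0 < l$1 - k$1"
    using * by auto
  from *(4) consider "0 < orient p k l" "0 < orient k l q" | "orient p k l < 0" "orient k l q < 0"
    by (auto simp: zero_less_mult_iff)
  then show thesis
  proof cases
    case 1
    have "0 < (l$1 - k$1) * orient p l q" "0 < (l$1 - k$1) * orient p k q"
      unfolding orient_chain(1,2)[of l k p q] by (intro add_pos_pos mult_pos_pos c 1)+
    then show thesis using 1 that(1) c(5) by (meson pos_of_scaled)
  next
    case 2
    have "(l$1 - k$1) * orient p l q < 0" "(l$1 - k$1) * orient p k q < 0"
      unfolding orient_chain(1,2)[of l k p q] by (intro add_neg_neg mult_pos_neg c 2)+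
    then show thesis using 2 that(2) c(5) by (meson neg_of_scaled)
  qed
qed

text \<open>A monotone chain with equal turns is convex with cyclic order \<open>p\<close>,
  \<open>k\<close>, \<open>l\<close>, \<open>q\<close>; here \<open>pq\<close> is a side and the
  diagonals are \<open>pl\<close> and \<open>kq\<close>.\<close>

lemma same_quad_crossing:
  assumes "same_quad p q k l"
  shows "crossing p l k q"
proof -
  have [simp]: "orient p l k = - orient p k l" "orient k q p = orient p k q" "orient k q l = - orient k l q"
    by (simp_all add: orient_def algebra_simps)
  show ?thesis
    using same_quad_signs[OF assms]
    by cases (simp_all add: crossing_def mult_neg_pos mult_pos_neg mult_neg_neg)
qed

section \<open>From normalised quadrilaterals to holes\<close>

lemma quad_convex_position:
  assumes "quad p q k l"
  shows "convex_position {p, q, k, l}"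
proof -
  have eq: "{p, k, q, l} = {p, q, k, l}" "{p, k, l, q} = {p, q, k, l}" by auto
  from assms consider "opposite_quad p q k l" | "same_quad p q k l" by (auto simp: quad_def)
  then show ?thesis
  proof cases
    case 1
    from crossing_convex_position[OF opposite_quad_crossing[OF this]] show ?thesis by (simp only: eq)
  next
    case 2
    from crossing_convex_position[OF same_quad_crossing[OF this]] show ?thesis by (simp only: eq)
  qed
qed

lemma quad_less:
  assumes "quad p q k l"
  shows "p$1 < k$1 \<and> k$1 < q$1 \<and> p$1 < l$1 \<and> l$1 < q$1"
  using assms by (auto simp: quad_def opposite_quad_def same_quad_def)

lemma quad_distinct:
  assumes "quad p q k l"
  shows "p \<noteq> q \<and> p \<noteq> k \<and> p \<noteq> l \<and> q \<noteq> k \<and> q \<noteq> l \<and> k \<noteq> l"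
  using assms by (auto simp: quad_def opposite_quad_def same_quad_def)

lemma quad_region_subset_hull:
  assumes "quad_region p q k l y"
  shows "y \<in> convex hull {p, q, k, l}"
proof -
  have "\<exists>a b c. {a, b, c} \<subseteq> {p, q, k, l} \<and> in_triangle a b c y"
    using assms unfolding quad_region_def by (metis insert_subset insertI1 insertI2 empty_subsetI)
  then show ?thesis by (meson hull_mono in_mono in_triangle_subset_hull)
qed

text \<open>A diagonal splits the hull into two closed triangles, and general position keeps the
  other sample points off all their sides, the diagonal included.\<close>

lemma quad_hull_imp_region:
  assumes q: "quad p q k l" and gp: "general_position S" and S: "{p, q, k, l} \<subseteq> S" "y \<in> S - {p, q, k, l}"
    and y: "y \<in> convex hull {p, q, k, l}"
  shows "quad_region p q k l y"
proof -
  have T: "in_triangle a b c y" if y: "y \<in> convex hull {a, b, c}" and sub: "{a, b, c} \<subseteq> {p, q, k, l}"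
      and d: "a \<noteq> b" "b \<noteq> c" "a \<noteq> c" for a b c
  proof -
    have "a \<in> S" "b \<in> S" "c \<in> S" "y \<in> S" "y \<noteq> a" "y \<noteq> b" "y \<noteq> c" using sub S by blast+
    then show ?thesis
      using gp d y unfolding general_position_iff by (simp add: hull_imp_in_triangle)
  qed
  note d = quad_distinct[OF q]
  show ?thesis
  proof (cases "opposite_quad p q k l")
    case True
    have eq: "{p, k, q, l} = {p, q, k, l}" "{p, k, q} = {p, q, k}" by auto
    have "y \<in> convex hull {p, q, k} \<or> y \<in> convex hull {p, q, l}"
      using y crossing_hull_subset[OF opposite_quad_crossing[OF True], unfolded eq] by blast
    then have "in_triangle p q k y \<or> in_triangle p q l y"
      using T[of p q k] T[of p q l] d by blast
    then show ?thesis using True by (simp add: quad_region_def)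
  next
    case False
    then have s: "same_quad p q k l" using q by (simp add: quad_def)
    have eq: "{p, k, l, q} = {p, q, k, l}" "{p, k, l} = {p, l, k}" by auto
    have "y \<in> convex hull {p, l, k} \<or> y \<in> convex hull {p, l, q}"
      using y crossing_hull_subset[OF same_quad_crossing[OF s], unfolded eq] by blast
    then have "in_triangle p l k y \<or> in_triangle p l q y"
      using T[of p l k] T[of p l q] d by blast
    then show ?thesis using False by (simp add: quad_region_def)
  qed
qed

lemma hole_of_quad:
  assumes q: "quad p q k l" and gp: "general_position S" and S: "{p, q, k, l} \<subseteq> S"
    and e: "\<forall>y\<in>S - {p, q, k, l}. \<not> quad_region p q k l y"
  shows "hole 4 S {p, q, k, l}"
proof -
  have "card {p, q, k, l} = 4" using quad_distinct[OF q] by auto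
  moreover have "interior (convex hull {p, q, k, l}) \<inter> S = {}"
  proof (rule ccontr)
    assume "interior (convex hull {p, q, k, l}) \<inter> S \<noteq> {}"
    then obtain y where y: "y \<in> interior (convex hull {p, q, k, l})" "y \<in> S" by blast
    \<comment> \<open>The hypothesis says nothing about the vertices; convex position keeps them out
      of the interior.\<close>
    then have "y \<in> S - {p, q, k, l}"
      using convex_position_interior[OF quad_convex_position[OF q]] by blast
    moreover have "y \<in> convex hull {p, q, k, l}"
      using y(1) interior_subset by blast
    ultimately show False using quad_hull_imp_region[OF q gp S] e by blast
  qed
  ultimately show ?thesis
    unfolding hole_def using gp S quad_convex_position[OF q] by blast
qed

text \<open>Here \<open>u\<close> and \<open>v\<close> stand for the scaled heights of the middle
  points over the base. A chain above its base that turns upwards at the first of them must turn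
  downwards at the second to reach the end of the base.\<close>

lemma chain_sign:
  fixes p k l q u v :: real
  assumes "p < k" "k < l" "l < q" "0 < u" "0 < v" "0 < (k - p) * v - (l - p) * u"
  shows "(q - l) * u - (q - k) * v < 0"
proof -
  have "(k - p) * u < (l - p) * u" using assms(2,4) by (intro mult_strict_right_mono) auto
  also have "\<dots> < (k - p) * v" using assms(6) by linarith
  finally have "u < v" using assms(1) by (simp add: mult_less_cancel_left_pos)
  then have "(q - l) * u < (q - k) * v" using assms(2-5) by (intro mult_strict_mono) auto
  then show ?thesis by simp
qed

text \<open>If the two turns have different signs, exactly one of \<open>k\<close>, \<open>l\<close>
  is a reflex corner seen from \<open>pq\<close>, and it lies in the triangle spanned by
  \<open>p\<close>, \<open>q\<close> and the other one.\<close>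

lemma same_side_cases:
  assumes x: "p$1 < k$1" "k$1 < l$1" "l$1 < q$1"
    and o: "0 < orient p q k * orient p q l" and nz: "orient p k l \<noteq> 0" "orient k l q \<noteq> 0"
  shows "same_quad p q k l \<or> in_triangle p q l k \<or> in_triangle p q k l"
proof -
  define X Y where XY: "X = orient p k l" "Y = orient k l q"
  define K L where KL: "K = orient p q k" "L = orient p q l"
  have o1: "orient q l k = - Y" and o2: "orient l p k = X"
    and o3: "orient q k l = Y" and o4: "orient k p l = - X"
    by (simp_all add: XY orient_def algebra_simps)
  have b: "0 < q$1 - p$1" using x by simp
  have cX: "(q$1 - p$1) * X = (k$1 - p$1) * L - (l$1 - p$1) * K"
    and cY: "(q$1 - p$1) * Y = (q$1 - l$1) * K - (q$1 - k$1) * L"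
    unfolding XY KL by (rule orient_chain)+
  have pos: "Y < 0" if "0 < X" "0 < K" "0 < L"
  proof -
    have "0 < (k$1 - p$1) * L - (l$1 - p$1) * K" using that b unfolding cX[symmetric] by simp
    from chain_sign[OF x that(2,3) this] show ?thesis using neg_of_scaled[OF b] cY by simp
  qed
  have neg: "0 < Y" if "X < 0" "K < 0" "L < 0"
  proof -
    have "0 < (k$1 - p$1) * (- L) - (l$1 - p$1) * (- K)"
      using mult_pos_neg[OF b that(1)] unfolding cX by simp
    from chain_sign[OF x _ _ this] that have "0 < (q$1 - p$1) * Y" unfolding cY by simp
    then show ?thesis using pos_of_scaled[OF b] by simp
  qed
  have same: "same_quad p q k l \<longleftrightarrow> 0 < X * Y"
    using x by (simp add: same_quad_def XY)
  have T1: "in_triangle p q l k \<longleftrightarrow> 0 < K \<and> Y < 0 \<and> 0 < X \<or> K < 0 \<and> 0 < Y \<and> X < 0"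
    by (simp add: in_triangle_def o1 o2 KL)
  have T2: "in_triangle p q k l \<longleftrightarrow> 0 < L \<and> 0 < Y \<and> X < 0 \<or> L < 0 \<and> Y < 0 \<and> 0 < X"
    by (simp add: in_triangle_def o3 o4 KL)
  have "0 < K \<and> 0 < L \<or> K < 0 \<and> L < 0" using o by (simp add: KL zero_less_mult_iff)
  moreover have "X < 0 \<or> 0 < X" "Y < 0 \<or> 0 < Y" using nz by (auto simp: XY)
  ultimately show ?thesis
    unfolding same T1 T2 zero_less_mult_iff using pos neg by argo
qed

text \<open>The vertices are excluded from the emptiness condition so that it only concerns sample points
  that are independent of them.\<close>

definition empty_quads :: "(real^2) set \<Rightarrow> ((real^2) \<times> (real^2) \<times> (real^2) \<times> (real^2)) set" where
  "empty_quads S = {(p, q, k, l). {p, q, k, l} \<subseteq> S \<and> quad p q k l \<and>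
     (\<forall>y\<in>S - {p, q, k, l}. \<not> quad_region p q k l y)}"

text \<open>Distinct first coordinates make the leftmost and rightmost vertices unique and strict; a
  reflex corner would contradict \<open>hole_4_iff\<close>.\<close>

lemma hole_obtains_quad:
  assumes h: "hole 4 S H" and inj: "inj_on (\<lambda>p. p$1) S"
  obtains p q k l where "H = {p, q, k, l}" "(p, q, k, l) \<in> empty_quads S"
proof -
  have gp: "general_position S" and HS: "H \<subseteq> S" and card: "card H = 4"
    and T: "\<And>a b c y. a \<in> H \<Longrightarrow> b \<in> H \<Longrightarrow> c \<in> H \<Longrightarrow> y \<in> S \<Longrightarrow> \<not> in_triangle a b c y"
    using h by (auto simp: hole_4_iff)
  have fin: "finite H" "H \<noteq> {}" using card by (auto intro: card_ge_0_finite)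
  have lt: "a$1 < b$1" if "a$1 \<le> b$1" "a \<noteq> b" "a \<in> H" "b \<in> H" for a b
    using that inj HS by (metis inj_onD less_le subsetD)
  obtain p where p: "p \<in> H" "\<And>y. y \<in> H \<Longrightarrow> p$1 \<le> y$1"
    using ex_min_if_finite[of "(\<lambda>p. p$1) ` H"] fin by (metis arg_min_if_finite(1) arg_min_least)
  obtain q where q: "q \<in> H" "\<And>y. y \<in> H \<Longrightarrow> - (q$1) \<le> - (y$1)"
    using fin arg_min_if_finite(1)[of H "\<lambda>q. - (q$1)"] arg_min_least[of H _ "\<lambda>q. - (q$1)"] by metis
  have "p \<noteq> q"
  proof
    assume "p = q"
    then have "y = p" if "y \<in> H" for y using p q lt that by force
    then have "H \<subseteq> {p}" by auto
    then show False using card card_mono[of "{p}" H] by simp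
  qed
  then have "card (H - {p, q}) = 2" using card p q fin by (simp add: card_Diff_subset)
  then obtain k l where kl: "H - {p, q} = {k, l}" "k \<noteq> l" by (auto simp: card_2_iff)
  have H: "H = {p, q, k, l}" using kl p q by auto
  have "k \<in> H - {p, q}" "l \<in> H - {p, q}" using kl by auto
  then have mid: "k \<in> H" "l \<in> H" "k \<noteq> p" "k \<noteq> q" "l \<noteq> p" "l \<noteq> q" by auto
  have x: "p$1 < k$1" "k$1 < q$1" "p$1 < l$1" "l$1 < q$1"
    using mid p q by (auto intro!: lt)
  have gpD: "orient a b c \<noteq> 0" if "a \<in> H" "b \<in> H" "c \<in> H" "a \<noteq> b" "b \<noteq> c" "a \<noteq> c" for a b c
    using gp that HS by (auto simp: general_position_iff)
  \<comment> \<open>Naming rule: on opposite sides of \<open>pq\<close>, \<open>k\<close> is the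
    vertex with positive orientation; on the same side, it is the one further left.\<close>
  have quad: "\<exists>k' l'. {k', l'} = {k, l} \<and> quad p q k' l'"
  proof (cases "0 < orient p q k * orient p q l")
    case False
    moreover have "orient p q k \<noteq> 0" "orient p q l \<noteq> 0" using gpD p q mid \<open>p \<noteq> q\<close> by auto
    ultimately have "orient p q k < 0 \<and> 0 < orient p q l \<or> orient p q l < 0 \<and> 0 < orient p q k"
      by (auto simp: zero_less_mult_iff not_less_iff_gr_or_eq)
    then show ?thesis using x by (auto simp: quad_def opposite_quad_def)
  next
    case True
    have *: "quad p q a b" if "{a, b} = {k, l}" "a$1 < b$1" for a b
    proof -
      have ab: "a \<in> H" "b \<in> H" "a \<noteq> p" "a \<noteq> q" "b \<noteq> p" "b \<noteq> q" "p$1 < a$1" "b$1 < q$1" "a \<noteq> b"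
        using that mid x by (auto simp: doubleton_eq_iff)
      have "0 < orient p q a * orient p q b"
        using True that by (auto simp: doubleton_eq_iff mult.commute)
      then have "same_quad p q a b \<or> in_triangle p q b a \<or> in_triangle p q a b"
        using ab that p q by (intro same_side_cases gpD) auto
      then show ?thesis using T p q ab HS by (auto simp: quad_def)
    qed
    show ?thesis
    proof (cases "k$1 < l$1")
      case True then show ?thesis using * by blast
    next
      case False
      then have "l$1 < k$1" using lt[of l k] mid kl(2) by auto
      then show ?thesis using *[of l k] by (metis insert_commute)
    qed
  qed
  then obtain k' l' where kl': "{k', l'} = {k, l}" "quad p q k' l'" by blast
  have H': "H = {p, q, k', l'}" using H kl'(1) by auto
  moreover have "(p, q, k', l') \<in> empty_quads S"
    using kl'(2) HS T unfolding empty_quads_def quad_region_def H' by auto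
  ultimately show thesis by (rule that)
qed

text \<open>The extremes fix \<open>p\<close> and \<open>q\<close>. Exchanging \<open>k\<close> and
  \<open>l\<close> is impossible within one type by asymmetry, and across types because the sign of
  \<open>orient p q k * orient p q l\<close> tells the types apart.\<close>

lemma quad_unique:
  assumes q: "quad p q k l" "quad p' q' k' l'" and eq: "{p, q, k, l} = {p', q', k', l'}"
  shows "(p, q, k, l) = (p', q', k', l')"
proof -
  note l = quad_less[OF q(1)] quad_less[OF q(2)]
  have "p \<in> {p', q', k', l'}" "q \<in> {p', q', k', l'}" "p' \<in> {p, q, k, l}" "q' \<in> {p, q, k, l}"
    using eq by blast+
  with l have pq: "p = p'" "q = q'" by (auto simp: less_le_not_le)
  have "{k, l} = {p, q, k, l} - {p, q}" using quad_distinct[OF q(1)] by auto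
  also have "\<dots> = {p', q', k', l'} - {p', q'}" by (simp only: eq) (simp only: pq)
  also have "\<dots> = {k', l'}" using quad_distinct[OF q(2)] by auto
  finally have "{k, l} = {k', l'}" .
  then consider "k = k'" "l = l'" | "k = l'" "l = k'" by (auto simp: doubleton_eq_iff)
  then show ?thesis
  proof cases
    case 1 with pq show ?thesis by simp
  next
    case 2
    have 1: "quad p q k l" "quad p q l k" using q pq 2 by auto
    have no: False if s: "same_quad p q a b" and o: "orient p q a * orient p q b < 0" for a b
    proof -
      have "0 < orient p a q * orient p b q"
        using same_quad_signs[OF s] by cases (simp_all add: mult_neg_neg)
      also have "\<dots> = orient p q a * orient p q b"
        by (simp only: orient_swap2[of p q a] orient_swap2[of p q b] minus_mult_minus)
      finally show False using o by simp
    qed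
    have sgn: "orient p q k * orient p q l < 0"
      if "opposite_quad p q k l \<or> opposite_quad p q l k"
      using that unfolding opposite_quad_def by (auto simp: mult_less_0_iff)
    have "\<not> (opposite_quad p q k l \<and> opposite_quad p q l k)"
      "\<not> (same_quad p q k l \<and> same_quad p q l k)"
      by (auto simp: opposite_quad_def same_quad_def)
    with 1 have "opposite_quad p q k l \<and> same_quad p q l k \<or> opposite_quad p q l k \<and> same_quad p q k l"
      unfolding quad_def by blast
    then show ?thesis using sgn no[of k l] no[of l k] by (auto simp: mult.commute)
  qed
qed

lemma card_holes_eq_card_quads:
  assumes gp: "general_position S" and inj: "inj_on (\<lambda>p. p$1) S"
  shows "card {H. hole 4 S H} = card (empty_quads S)"
proof -
  have "bij_betw (\<lambda>(p, q, k, l). {p, q, k, l}) (empty_quads S) {H. hole 4 S H}"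
    unfolding bij_betw_def
  proof
    show "inj_on (\<lambda>(p, q, k, l). {p, q, k, l}) (empty_quads S)"
    proof (rule inj_onI)
      fix s t assume "s \<in> empty_quads S" "t \<in> empty_quads S"
        and eq: "(\<lambda>(p, q, k, l). {p, q, k, l}) s = (\<lambda>(p, q, k, l). {p, q, k, l}) t"
      moreover obtain p q k l where s: "s = (p, q, k, l)" by (cases s)
      moreover obtain p' q' k' l' where t: "t = (p', q', k', l')" by (cases t)
      ultimately have "quad p q k l" "quad p' q' k' l'" by (simp_all add: empty_quads_def)
      then show "s = t" using quad_unique eq unfolding s t by simp
    qed
    show "(\<lambda>(p, q, k, l). {p, q, k, l}) ` empty_quads S = {H. hole 4 S H}"
    proof (intro equalityI subsetI)
      fix H assume "H \<in> {H. hole 4 S H}"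
      then have "hole 4 S H" by simp
      then obtain p q k l where "H = {p, q, k, l}" "(p, q, k, l) \<in> empty_quads S"
        using inj by (rule hole_obtains_quad)
      then show "H \<in> (\<lambda>(p, q, k, l). {p, q, k, l}) ` empty_quads S"
        by (metis (mono_tags, lifting) case_prod_conv image_eqI)
    next
      fix H assume "H \<in> (\<lambda>(p, q, k, l). {p, q, k, l}) ` empty_quads S"
      then obtain p q k l where H: "H = {p, q, k, l}" "(p, q, k, l) \<in> empty_quads S" by auto
      then show "H \<in> {H. hole 4 S H}"
        using hole_of_quad[OF _ gp, of p q k l] by (simp add: empty_quads_def)
    qed
  qed
  then show ?thesis by (rule bij_betw_same_card[symmetric])
qed

section \<open>Areas and measurability\<close>

lemma AE_lborel_orient_nz:
  assumes "a \<noteq> b"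
  shows "AE y in lborel. orient a b y \<noteq> 0"
proof -
  let ?n = "vector [- (b$2 - a$2), b$1 - a$1] :: real^2"
  have nz: "?n \<noteq> 0" using assms by (auto simp: vec_eq_iff forall_2)
  have "{y. orient a b y = 0} = {y. ?n \<bullet> y = ?n \<bullet> a}"
    by (auto simp: orient_def inner_vec_def sum_2 algebra_simps)
  then have "negligible {y. orient a b y = 0}" using nz by (simp add: negligible_hyperplane)
  moreover have "{y. orient a b y = 0} \<in> sets borel"
    by (intro borel_closed closed_Collect_eq continuous_intros)
  ultimately have "{y. orient a b y = 0} \<in> null_sets lborel"
    by (simp add: negligible_iff_null_sets null_sets_completion_iff)
  then show ?thesis by (rule AE_I') auto
qed

lemma AE_lborel_nth_neq: "AE y in lborel. y$i \<noteq> (c::real)"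
proof -
  have "negligible {y::real^'a. axis i 1 \<bullet> y = c}"
    by (rule negligible_hyperplane) (simp add: axis_eq_0_iff)
  moreover have "{y::real^'a. axis i 1 \<bullet> y = c} \<in> sets borel"
    by (intro borel_closed closed_Collect_eq continuous_intros)
  ultimately have "{y::real^'a. axis i 1 \<bullet> y = c} \<in> null_sets lborel"
    by (simp add: negligible_iff_null_sets null_sets_completion_iff)
  then show ?thesis by (rule AE_I') (auto simp: inner_axis')
qed

section \<open>Measurability of the geometric predicates, and areas\<close>

lemma measurable_vec_nth [measurable (raw)]:
  assumes "f \<in> borel_measurable M"
  shows "(\<lambda>x. (f x :: real^'n) $ i) \<in> borel_measurable M"
  using measurable_compose[OF assms, of "\<lambda>x. x $ i" borel] by simp

lemma measurable_orient [measurable (raw)]: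
  "f \<in> borel_measurable M \<Longrightarrow> g \<in> borel_measurable M \<Longrightarrow> h \<in> borel_measurable M \<Longrightarrow>
    (\<lambda>x. orient (f x) (g x) (h x)) \<in> borel_measurable M"
  unfolding orient_def by (intro borel_measurable_diff borel_measurable_times measurable_vec_nth)

lemma measurable_in_triangle [measurable (raw)]:
  assumes [measurable]: "a \<in> borel_measurable M" "b \<in> borel_measurable M"
    "c \<in> borel_measurable M" "y \<in> borel_measurable M"
  shows "Measurable.pred M (\<lambda>x. in_triangle (a x) (b x) (c x) (y x))"
  unfolding in_triangle_def by measurable

lemma measurable_opposite_quad [measurable (raw)]:
  assumes [measurable]: "p \<in> borel_measurable M" "q \<in> borel_measurable M"
    "k \<in> borel_measurable M" "l \<in> borel_measurable M"
  shows "Measurable.pred M (\<lambda>x. opposite_quad (p x) (q x) (k x) (l x))"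
  unfolding opposite_quad_def by measurable

lemma measurable_quad [measurable (raw)]:
  assumes [measurable]: "p \<in> borel_measurable M" "q \<in> borel_measurable M"
    "k \<in> borel_measurable M" "l \<in> borel_measurable M"
  shows "Measurable.pred M (\<lambda>x. quad (p x) (q x) (k x) (l x))"
  unfolding quad_def same_quad_def by measurable

lemma measurable_quad_region [measurable (raw)]:
  assumes [measurable]: "p \<in> borel_measurable M" "q \<in> borel_measurable M"
    "k \<in> borel_measurable M" "l \<in> borel_measurable M" "y \<in> borel_measurable M"
  shows "Measurable.pred M (\<lambda>x. quad_region (p x) (q x) (k x) (l x) (y x))"
  unfolding quad_region_def by measurable

lemma measurable_quad_area [measurable (raw)]:
  assumes [measurable]: "p \<in> borel_measurable M" "q \<in> borel_measurable M"
    "k \<in> borel_measurable M" "l \<in> borel_measurable M"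
  shows "(\<lambda>x. quad_area (p x) (q x) (k x) (l x)) \<in> borel_measurable M"
  unfolding quad_area_def by measurable

text \<open>The open triangle and the hull differ only on three lines, which are null sets.\<close>

lemma emeasure_in_triangle:
  "emeasure lborel {y. in_triangle a b c y} = ennreal (\<bar>orient a b c\<bar> / 2)"
proof (cases "orient a b c = 0")
  case True
  have "\<not> in_triangle a b c y" for y
    using orient_split[of a b y c] True by (auto simp: in_triangle_def)
  then show ?thesis using True by simp
next
  case False
  then have ne: "a \<noteq> b" "b \<noteq> c" "c \<noteq> a" by auto
  have "AE y in lborel. y \<in> {y. in_triangle a b c y} \<longleftrightarrow> y \<in> convex hull {a, b, c}"
    using AE_lborel_orient_nz[OF ne(1)] AE_lborel_orient_nz[OF ne(2)] AE_lborel_orient_nz[OF ne(3)]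
  proof eventually_elim
    case (elim y)
    then show ?case using in_triangle_subset_hull hull_imp_in_triangle by blast
  qed
  moreover have cpt: "compact (convex hull {a, b, c})"
    by (intro compact_convex_hull finite_imp_compact) simp
  moreover have "{y. in_triangle a b c y} \<in> sets borel"
    using open_in_triangle by (rule borel_open)
  ultimately have "emeasure lborel {y. in_triangle a b c y} = emeasure lborel (convex hull {a, b, c})"
    by (intro emeasure_eq_AE) (auto intro: borel_compact)
  also have "\<dots> = ennreal (measure lborel (convex hull {a, b, c}))"
    using emeasure_compact_finite[OF cpt] by (intro emeasure_eq_ennreal_measure) auto
  also have "measure lborel (convex hull {a, b, c}) = \<bar>orient a b c\<bar> / 2"
    using content_triangle[of a b c] cpt
    by (simp add: measure_completion borel_compact orient_def abs_minus_commute mult.commute)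
  finally show ?thesis .
qed

lemma in_triangle_sign:
  assumes "in_triangle a b c y"
  shows "0 < orient a b y \<and> 0 < orient a b c \<or> orient a b y < 0 \<and> orient a b c < 0"
  using assms orient_split[of a b y c] unfolding in_triangle_def by linarith

text \<open>Treats both types at once: the common base \<open>ab\<close> is the diagonal
  \<open>pq\<close> or \<open>pl\<close>, and the apexes lie on opposite sides of it, whence
  disjointness.\<close>

lemma quad_region_Un:
  assumes q: "quad p q k l"
  obtains a b c c' where "{y. quad_region p q k l y} = {y. in_triangle a b c y} \<union> {y. in_triangle a b c' y}"
    "{y. in_triangle a b c y} \<inter> {y. in_triangle a b c' y} = {}"
    "quad_area p q k l = \<bar>orient a b c\<bar> / 2 + \<bar>orient a b c'\<bar> / 2"
proof -
  have disj: "{y. in_triangle a b c y} \<inter> {y. in_triangle a b c' y} = {}"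
    if "orient a b c * orient a b c' < 0" for a b c c'
    using that in_triangle_sign[of a b c] in_triangle_sign[of a b c'] unfolding mult_less_0_iff
    by (metis (mono_tags, lifting) disjoint_iff mem_Collect_eq not_less_iff_gr_or_eq)
  show thesis
  proof (cases "opposite_quad p q k l")
    case True
    then have "orient p q k * orient p q l < 0"
      by (auto simp: opposite_quad_def mult_less_0_iff)
    then show thesis using True
      by (intro that[of p q k l] disj) (auto simp: quad_region_def quad_area_def)
  next
    case False
    then have "same_quad p q k l" using q by (simp add: quad_def)
    then have "orient p l k * orient p l q < 0"
      using same_quad_crossing by (simp add: crossing_def)
    then show thesis using False
      by (intro that[of p l k q] disj) (auto simp: quad_region_def quad_area_def)
  qed
qed

lemma emeasure_quad_region:
  assumes "quad p q k l"
  shows "emeasure lborel {y. quad_region p q k l y} = ennreal (quad_area p q k l)"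
proof -
  obtain a b c c' where *: "{y. quad_region p q k l y} = {y. in_triangle a b c y} \<union> {y. in_triangle a b c' y}"
    "{y. in_triangle a b c y} \<inter> {y. in_triangle a b c' y} = {}"
    "quad_area p q k l = \<bar>orient a b c\<bar> / 2 + \<bar>orient a b c'\<bar> / 2"
    using assms by (rule quad_region_Un)
  show ?thesis
    unfolding *(1,3)
    by (subst plus_emeasure[OF _ _ *(2), symmetric])
       (simp_all add: emeasure_in_triangle borel_open open_in_triangle)
qed

lemma quad_area_nonneg: "0 \<le> quad_area p q k l"
  by (simp add: quad_area_def)

section \<open>Measurability of the number of holes\<close>

lemma card_image_preimage:
  assumes inj: "inj_on f C" and im: "f ` C = f ` A" and P: "\<And>H. P H \<Longrightarrow> H \<subseteq> f ` A"
  shows "card {H. P H} = card {I. I \<subseteq> C \<and> P (f ` I)}"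
proof -
  have "bij_betw ((`) f) {I. I \<subseteq> C \<and> P (f ` I)} {H. P H}"
    unfolding bij_betw_def
  proof
    show "inj_on ((`) f) {I. I \<subseteq> C \<and> P (f ` I)}"
      using inj by (auto simp: inj_on_def inj_on_image_eq_iff)
    show "(`) f ` {I. I \<subseteq> C \<and> P (f ` I)} = {H. P H}"
    proof (intro equalityI subsetI)
      fix H assume "H \<in> {H. P H}"
      then have "P H" "H \<subseteq> f ` C" using P im by auto
      then show "H \<in> (`) f ` {I. I \<subseteq> C \<and> P (f ` I)}"
        by (auto simp: subset_image_iff)
    qed auto
  qed
  then show ?thesis by (rule bij_betw_same_card[symmetric])
qed

text \<open>Coinciding sample points are represented by the first index at which they occur.\<close>

definition first_indices :: "nat \<Rightarrow> (nat \<Rightarrow> 'a) \<Rightarrow> nat set" where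
  "first_indices n x = {i. i < n \<and> (\<forall>j<i. x j \<noteq> x i)}"

lemma inj_on_first_indices: "inj_on x (first_indices n x)"
  unfolding inj_on_def first_indices_def by (metis (mono_tags, lifting) linorder_neqE_nat mem_Collect_eq)

lemma image_first_indices: "x ` first_indices n x = x ` {..<n}"
proof (intro equalityI subsetI)
  fix y assume "y \<in> x ` {..<n}"
  then obtain i where i: "i < n" "x i = y" by auto
  define m where "m = (LEAST j. x j = y)"
  have "x m = y" unfolding m_def using i by (intro LeastI[of "\<lambda>j. x j = y"])
  moreover have "m \<le> i" unfolding m_def using i by (intro Least_le)
  moreover have "x j \<noteq> y" if "j < m" for j using that not_less_Least unfolding m_def by blast
  ultimately show "y \<in> x ` first_indices n x"
    using i by (intro image_eqI[of _ _ m]) (auto simp: first_indices_def)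
qed (auto simp: first_indices_def)

lemma general_position_image:
  fixes n :: nat
  shows "general_position (x ` {..<n}) \<longleftrightarrow>
    (\<forall>i\<in>{..<n}. \<forall>j\<in>{..<n}. \<forall>k\<in>{..<n}.
      x i \<noteq> x j \<longrightarrow> x j \<noteq> x k \<longrightarrow> x i \<noteq> x k \<longrightarrow> orient (x i) (x j) (x k) \<noteq> 0)"
  by (simp add: general_position_iff)

lemma hole_4_image:
  assumes "I \<subseteq> first_indices n x"
  shows "hole 4 (x ` {..<n}) (x ` I) \<longleftrightarrow> card I = 4 \<and> general_position (x ` {..<n}) \<and>
     (\<forall>a\<in>I. \<forall>b\<in>I. \<forall>c\<in>I. \<forall>m\<in>{..<n}. \<not> in_triangle (x a) (x b) (x c) (x m))"
proof -
  have "card (x ` I) = card I"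
    using assms inj_on_first_indices inj_on_subset card_image by metis
  moreover have "x ` I \<subseteq> x ` {..<n}" using assms by (auto simp: first_indices_def)
  ultimately show ?thesis by (auto simp: hole_4_iff)
qed

lemma card_filter_eq_sum: "finite A \<Longrightarrow> real (card {x\<in>A. P x}) = (\<Sum>x\<in>A. of_bool (P x))"
  by (simp add: Int_def)

text \<open>The sum runs over index sets that do not vary with \<open>x\<close>; the first conjunct
  of the indicator says \<open>I \<subseteq> first_indices n x\<close>, so each hole is counted once
  even if sample points coincide.\<close>

lemma card_holes_eq_sum:
  fixes n :: nat
  shows "real (card {H. hole 4 (x ` {..<n}) H}) = (\<Sum>I\<in>{I\<in>Pow {..<n}. card I = 4}.
     of_bool ((\<forall>i\<in>I. \<forall>j\<in>{..<i}. x j \<noteq> x i) \<and> general_position (x ` {..<n}) \<and>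
     (\<forall>a\<in>I. \<forall>b\<in>I. \<forall>c\<in>I. \<forall>m\<in>{..<n}. \<not> in_triangle (x a) (x b) (x c) (x m))))"
proof -
  have "card {H. hole 4 (x ` {..<n}) H}
      = card {I. I \<subseteq> first_indices n x \<and> hole 4 (x ` {..<n}) (x ` I)}"
    by (rule card_image_preimage[OF inj_on_first_indices image_first_indices])
       (simp add: hole_4_iff)
  also have "{I. I \<subseteq> first_indices n x \<and> hole 4 (x ` {..<n}) (x ` I)} =
     {I\<in>{I\<in>Pow {..<n}. card I = 4}. (\<forall>i\<in>I. \<forall>j\<in>{..<i}. x j \<noteq> x i) \<and> general_position (x ` {..<n}) \<and>
       (\<forall>a\<in>I. \<forall>b\<in>I. \<forall>c\<in>I. \<forall>m\<in>{..<n}. \<not> in_triangle (x a) (x b) (x c) (x m))}" (is "?A = ?B")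
  proof -
    have "I \<in> ?A \<longleftrightarrow> I \<in> ?B" for I
    proof (cases "I \<subseteq> first_indices n x")
      case True
      then have "I \<subseteq> {..<n}" "\<forall>i\<in>I. \<forall>j\<in>{..<i}. x j \<noteq> x i" by (auto simp: first_indices_def)
      with True show ?thesis by (simp add: hole_4_image[OF True])
    next
      case False
      then have "\<not> (I \<subseteq> {..<n} \<and> (\<forall>i\<in>I. \<forall>j\<in>{..<i}. x j \<noteq> x i))"
        unfolding first_indices_def by blast
      with False show ?thesis by blast
    qed
    then show ?thesis by (rule set_eqI)
  qed
  finally have eq: "card {H. hole 4 (x ` {..<n}) H} = card ?B" .
  have "finite {I \<in> Pow {..<n}. card I = 4}"
    by (rule finite_subset[of _ "Pow {..<n}"]) auto
  then show ?thesis unfolding eq by (rule card_filter_eq_sum)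
qed

lemma pred_eq_borel:
  fixes f g :: "'a \<Rightarrow> 'b::{second_countable_topology, t2_space}"
  assumes "f \<in> borel_measurable M" "g \<in> borel_measurable M"
  shows "Measurable.pred M (\<lambda>x. f x = g x)"
  unfolding pred_def using assms by (rule measurable_equality_set)

text \<open>\<open>expected_holes\<close> is a Bochner integral, which defaults to 0 for
  non-measurable functions, so this is needed before it can be computed as a nonnegative
  integral.\<close>

lemma measurable_card_holes:
  fixes U :: "(real^2) measure" and n :: nat
  assumes [measurable_cong]: "sets U = sets borel"
  shows "(\<lambda>x. real (card {H. hole 4 (x ` {..<n}) H})) \<in> borel_measurable (Pi\<^sub>M {..<n} (\<lambda>_. U))"
proof -
  let ?M = "Pi\<^sub>M {..<n} (\<lambda>_. U)"
  have comp: "(\<lambda>x. x i) \<in> borel_measurable ?M" if "i \<in> {..<n}" for i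
    using measurable_component_singleton[OF that, of "\<lambda>_. U"]
    by (simp only: measurable_cong_sets[OF refl assms])
  have eq: "Measurable.pred ?M (\<lambda>x. x i = x j)" if "i \<in> {..<n}" "j \<in> {..<n}" for i j
    by (intro pred_eq_borel comp that)
  have [measurable]: "Measurable.pred ?M (\<lambda>x. general_position (x ` {..<n}))"
    unfolding general_position_image
    by (intro pred_intros_finite finite_lessThan pred_intros_logic eq pred_eq_borel measurable_orient comp
        borel_measurable_const)
  have *: "(\<lambda>x. of_bool ((\<forall>i\<in>I. \<forall>j\<in>{..<i}. x j \<noteq> x i) \<and> general_position (x ` {..<n}) \<and>
     (\<forall>a\<in>I. \<forall>b\<in>I. \<forall>c\<in>I. \<forall>m\<in>{..<n}. \<not> in_triangle (x a) (x b) (x c) (x m))) :: real)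
      \<in> borel_measurable ?M" if "I \<subseteq> {..<n}" for I
  proof -
    have fin: "finite I" using that finite_subset by blast
    have I: "i \<in> {..<n}" if "i \<in> I" for i using that \<open>I \<subseteq> {..<n}\<close> by blast
    have "Measurable.pred ?M (\<lambda>x. \<forall>i\<in>I. \<forall>j\<in>{..<i}. x j \<noteq> x i)"
    proof (intro pred_intros_finite fin finite_lessThan pred_intros_logic eq)
      fix i j assume ij: "i \<in> I" "j \<in> {..<i}"
      from I[OF ij(1)] ij(2) show "i \<in> {..<n}" "j \<in> {..<n}" by simp_all
    qed
    moreover have "Measurable.pred ?M
        (\<lambda>x. \<forall>a\<in>I. \<forall>b\<in>I. \<forall>c\<in>I. \<forall>m\<in>{..<n}. \<not> in_triangle (x a) (x b) (x c) (x m))"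
      by (intro pred_intros_finite fin finite_lessThan pred_intros_logic measurable_in_triangle comp)
        (assumption | rule I, assumption)+
    moreover note \<open>Measurable.pred ?M (\<lambda>x. general_position (x ` {..<n}))\<close>
    ultimately show ?thesis
      unfolding of_bool_def by (intro measurable_If predE pred_intros_logic measurable_const) simp_all
  qed
  show ?thesis
    unfolding card_holes_eq_sum by (rule borel_measurable_sum, rule *) simp
qed

text \<open>Fubini for null sets: it suffices to vary one coordinate with the others frozen.\<close>

lemma (in product_sigma_finite) AE_PiM_insertI:
  assumes I: "finite I" "i \<notin> I"
    and [measurable]: "Measurable.pred (Pi\<^sub>M (insert i I) M) P"
    and AE: "\<And>x. x \<in> space (Pi\<^sub>M I M) \<Longrightarrow> AE y in M i. P (x(i := y))"
  shows "AE x in Pi\<^sub>M (insert i I) M. P x"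
proof -
  have "(\<integral>\<^sup>+x. indicator {x. \<not> P x} x \<partial>Pi\<^sub>M (insert i I) M) =
      (\<integral>\<^sup>+x. (\<integral>\<^sup>+y. indicator {x. \<not> P x} (x(i := y)) \<partial>M i) \<partial>Pi\<^sub>M I M)"
    by (rule product_nn_integral_insert[OF I]) measurable
  also have "\<dots> = (\<integral>\<^sup>+x. 0 \<partial>Pi\<^sub>M I M)"
  proof (rule nn_integral_cong)
    fix x assume "x \<in> space (Pi\<^sub>M I M)"
    from AE[OF this] have "AE y in M i. indicator {x. \<not> P x} (x(i := y)) = (0::ennreal)"
      by eventually_elim simp
    then have "(\<integral>\<^sup>+y. indicator {x. \<not> P x} (x(i := y)) \<partial>M i) = (\<integral>\<^sup>+y. 0 \<partial>M i)"
      by (rule nn_integral_cong_AE)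
    then show "(\<integral>\<^sup>+y. indicator {x. \<not> P x} (x(i := y)) \<partial>M i) = 0" by simp
  qed
  finally show ?thesis
    by (subst AE_iff_nn_integral) (auto simp: predE)
qed

section \<open>The expectation as an integral over four points\<close>

text \<open>A product with one 0/1 factor per remaining index, so that independence turns its
  integral into a power.\<close>

definition empty_quad_weight ::
    "nat set \<Rightarrow> real^2 \<Rightarrow> real^2 \<Rightarrow> real^2 \<Rightarrow> real^2 \<Rightarrow> (nat \<Rightarrow> real^2) \<Rightarrow> ennreal" where
  "empty_quad_weight R p q k l x =
     (if quad p q k l then \<Prod>m\<in>R. (if quad_region p q k l (x m) then 0 else 1) else 0)"

definition empty_quad_integral :: "(real^2) measure \<Rightarrow> nat \<Rightarrow> ennreal" where
  "empty_quad_integral U m = (\<integral>\<^sup>+p. \<integral>\<^sup>+q. \<integral>\<^sup>+k. \<integral>\<^sup>+l.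
     (if quad p q k l then (\<integral>\<^sup>+y. (if quad_region p q k l y then 0 else 1) \<partial>U) ^ m else 0) \<partial>U \<partial>U \<partial>U \<partial>U)"

lemma measurable_empty_quad_weight:
  assumes [measurable]: "p \<in> borel_measurable M" "q \<in> borel_measurable M"
    "k \<in> borel_measurable M" "l \<in> borel_measurable M"
    and x: "\<And>m. m \<in> R \<Longrightarrow> (\<lambda>w. x w m) \<in> borel_measurable M"
  shows "(\<lambda>w. empty_quad_weight R (p w) (q w) (k w) (l w) (x w)) \<in> borel_measurable M"
  unfolding empty_quad_weight_def
proof (rule measurable_If[OF borel_measurable_prod_ennreal])
  fix m assume "m \<in> R"
  note [measurable] = x[OF this]
  show "(\<lambda>w. if quad_region (p w) (q w) (k w) (l w) (x w m) then 0 else 1 :: ennreal) \<in> borel_measurable M"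
    by measurable
qed measurable

lemma empty_quad_weight_upd:
  "i \<notin> R \<Longrightarrow> empty_quad_weight R p q k l (x(i := y)) = empty_quad_weight R p q k l x"
  unfolding empty_quad_weight_def by (intro if_cong prod.cong refl) auto

text \<open>The four vertex coordinates are integrated out one at a time; the weight reads
  \<open>x\<close> only on \<open>R\<close>, so fixing a vertex leaves the remaining factors
  unchanged.\<close>

lemma nn_integral_empty_quad_weight:
  fixes U :: "(real^2) measure"
  assumes U: "prob_space U" and sets: "sets U = sets borel" and R: "finite R"
    and dist: "i \<notin> insert j (insert k (insert l R))" "j \<notin> insert k (insert l R)" "k \<notin> insert l R" "l \<notin> R"
  shows "(\<integral>\<^sup>+x. empty_quad_weight R (x i) (x j) (x k) (x l) x
      \<partial>Pi\<^sub>M (insert i (insert j (insert k (insert l R)))) (\<lambda>_. U)) = empty_quad_integral U (card R)"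
proof -
  interpret prob_space U by (rule U)
  interpret product_sigma_finite "\<lambda>_::nat. U" by standard
  have comp: "(\<lambda>x. x m) \<in> borel_measurable (Pi\<^sub>M I (\<lambda>_. U))" if "m \<in> I" for m I
    using measurable_component_singleton[OF that, of "\<lambda>_. U"]
    by (simp only: measurable_cong_sets[OF refl sets])
  note meas = measurable_empty_quad_weight comp measurable_const
  have ne: "i \<noteq> j" "i \<noteq> k" "i \<noteq> l" "j \<noteq> k" "j \<noteq> l" "k \<noteq> l" "i \<notin> R" "j \<notin> R" "k \<notin> R" "l \<notin> R"
    using dist by auto
  note upd = empty_quad_weight_upd[OF ne(7)] empty_quad_weight_upd[OF ne(8)]
    empty_quad_weight_upd[OF ne(9)] empty_quad_weight_upd[OF ne(10)]
  let ?Pi = "\<lambda>I. Pi\<^sub>M I (\<lambda>_::nat. U)"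
  have inner: "(\<integral>\<^sup>+x. empty_quad_weight R p q k l x \<partial>?Pi R) =
      (if quad p q k l then (\<integral>\<^sup>+y. (if quad_region p q k l y then 0 else 1) \<partial>U) ^ card R else 0)" for p q k l
  proof -
    note [measurable_cong] = sets
    have "(\<lambda>y. if quad_region p q k l y then 0 else 1 :: ennreal) \<in> borel_measurable U"
      by measurable
    then show ?thesis
      unfolding empty_quad_weight_def
      using product_nn_integral_prod[OF R, of "\<lambda>_ y. if quad_region p q k l y then 0 else 1"]
      by simp
  qed
  have "(\<integral>\<^sup>+x. empty_quad_weight R (x i) (x j) (x k) (x l) x \<partial>?Pi (insert i (insert j (insert k (insert l R)))))
     = (\<integral>\<^sup>+p. (\<integral>\<^sup>+x. empty_quad_weight R p (x j) (x k) (x l) x \<partial>?Pi (insert j (insert k (insert l R)))) \<partial>U)"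
    using R dist(1) ne
    by (subst product_nn_integral_insert_rev) (auto simp: upd intro!: meas)
  also have "\<dots> = (\<integral>\<^sup>+p. \<integral>\<^sup>+q. (\<integral>\<^sup>+x. empty_quad_weight R p q (x k) (x l) x \<partial>?Pi (insert k (insert l R))) \<partial>U \<partial>U)"
    using R dist(2) ne
    by (subst product_nn_integral_insert_rev) (auto simp: upd intro!: meas)
  also have "\<dots> = (\<integral>\<^sup>+p. \<integral>\<^sup>+q. \<integral>\<^sup>+k. (\<integral>\<^sup>+x. empty_quad_weight R p q k (x l) x \<partial>?Pi (insert l R)) \<partial>U \<partial>U \<partial>U)"
    using R dist(3) ne
    by (subst product_nn_integral_insert_rev) (auto simp: upd intro!: meas)
  also have "\<dots> = (\<integral>\<^sup>+p. \<integral>\<^sup>+q. \<integral>\<^sup>+k. \<integral>\<^sup>+l. (\<integral>\<^sup>+x. empty_quad_weight R p q k l x \<partial>?Pi R) \<partial>U \<partial>U \<partial>U \<partial>U)"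
    using R dist(4) ne
    by (subst product_nn_integral_insert_rev) (auto simp: upd intro!: meas)
  also have "\<dots> = empty_quad_integral U (card R)"
    unfolding inner empty_quad_integral_def ..
  finally show ?thesis .
qed

section \<open>Summation over quadruples of indices\<close>

definition distinct_quadruples :: "nat \<Rightarrow> (nat \<times> nat \<times> nat \<times> nat) set" where
  "distinct_quadruples n =
     (SIGMA i:{..<n}. SIGMA j:{..<n} - {i}. SIGMA k:{..<n} - {i, j}. {..<n} - {i, j, k})"

lemma finite_distinct_quadruples: "finite (distinct_quadruples n)"
  by (auto simp: distinct_quadruples_def)

text \<open>The fibres of the nested \<open>SIGMA\<close> have constant size. Truncated subtraction
  is harmless: for \<open>n < 4\<close> both sides are 0.\<close>

lemma card_distinct_quadruples: "card (distinct_quadruples n) = n * (n - 1) * (n - 2) * (n - 3)"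
proof -
  have 3: "card ({..<n} - {i, j, k}) = n - 3" if "i < n" "j < n" "j \<noteq> i" "k < n" "k \<noteq> i" "k \<noteq> j" for i j k
    using that by (subst card_Diff_subset) auto
  have 2: "card ({..<n} - {i, j}) = n - 2" if "i < n" "j < n" "j \<noteq> i" for i j
    using that by (subst card_Diff_subset) auto
  have 1: "card ({..<n} - {i}) = n - 1" if "i < n" for i
    using that by (subst card_Diff_subset) auto
  have "card (distinct_quadruples n) =
      (\<Sum>i<n. \<Sum>j\<in>{..<n} - {i}. \<Sum>k\<in>{..<n} - {i, j}. card ({..<n} - {i, j, k}))"
    by (simp add: distinct_quadruples_def)
  also have "\<dots> = (\<Sum>i<n. \<Sum>j\<in>{..<n} - {i}. \<Sum>k\<in>{..<n} - {i, j}. n - 3)"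
    by (intro sum.cong refl 3) auto
  also have "\<dots> = (\<Sum>i<n. \<Sum>j\<in>{..<n} - {i}. (n - 2) * (n - 3))"
    by (intro sum.cong refl) (simp add: 2 numeral_2_eq_2)
  also have "\<dots> = (\<Sum>i<n. (n - 1) * ((n - 2) * (n - 3)))"
    by (intro sum.cong refl) (simp add: 1)
  finally show ?thesis by (simp add: mult.assoc)
qed

lemma card_empty_quads_image:
  assumes inj: "inj_on x {..<n}"
  shows "of_nat (card (empty_quads (x ` {..<n}))) = (\<Sum>(i, j, k, l)\<in>distinct_quadruples n.
     empty_quad_weight ({..<n} - {i, j, k, l}) (x i) (x j) (x k) (x l) x)"
proof -
  define W where "W = (\<lambda>(i, j, k, l). quad (x i) (x j) (x k) (x l) \<and>
     (\<forall>m\<in>{..<n} - {i, j, k, l}. \<not> quad_region (x i) (x j) (x k) (x l) (x m)))"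
  let ?f = "\<lambda>(i, j, k, l). (x i, x j, x k, x l)"
  have bij: "bij_betw ?f {t \<in> distinct_quadruples n. W t} (empty_quads (x ` {..<n}))"
    unfolding bij_betw_def
  proof
    show "inj_on ?f {t \<in> distinct_quadruples n. W t}"
      using inj by (auto simp: inj_on_def distinct_quadruples_def)
    show "?f ` {t \<in> distinct_quadruples n. W t} = empty_quads (x ` {..<n})"
    proof (intro equalityI subsetI)
      fix s assume "s \<in> ?f ` {t \<in> distinct_quadruples n. W t}"
      then obtain i j k l where s: "s = (x i, x j, x k, x l)"
        and d: "(i, j, k, l) \<in> distinct_quadruples n" "W (i, j, k, l)" by auto
      then show "s \<in> empty_quads (x ` {..<n})"
        by (auto simp: empty_quads_def W_def distinct_quadruples_def)
    next
      fix s assume "s \<in> empty_quads (x ` {..<n})"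
      then obtain i j k l where s: "s = (x i, x j, x k, x l)" and lt: "i < n" "j < n" "k < n" "l < n"
        and q: "quad (x i) (x j) (x k) (x l)"
        and e: "\<And>y. y \<in> x ` {..<n} - {x i, x j, x k, x l} \<Longrightarrow> \<not> quad_region (x i) (x j) (x k) (x l) y"
        by (auto simp: empty_quads_def)
      have "(i, j, k, l) \<in> distinct_quadruples n"
        using quad_distinct[OF q] lt by (auto simp: distinct_quadruples_def)
      moreover have "W (i, j, k, l)"
        unfolding W_def
      proof (clarify, intro conjI q ballI)
        fix m assume "m \<in> {..<n} - {i, j, k, l}"
        then have "x m \<in> x ` {..<n} - {x i, x j, x k, x l}"
          using inj lt by (auto simp: inj_on_def)
        then show "\<not> quad_region (x i) (x j) (x k) (x l) (x m)" by (rule e)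
      qed
      ultimately show "s \<in> ?f ` {t \<in> distinct_quadruples n. W t}"
        unfolding s by (intro image_eqI[of _ _ "(i, j, k, l)"]) auto
    qed
  qed
  have w: "(case t of (i, j, k, l) \<Rightarrow>
      empty_quad_weight ({..<n} - {i, j, k, l}) (x i) (x j) (x k) (x l) x) = of_bool (W t)" for t
    by (cases t) (auto simp: W_def empty_quad_weight_def prod_zero_iff intro!: prod.neutral)
  show ?thesis
    unfolding w bij_betw_same_card[OF bij, symmetric]
    by (simp add: Int_def finite_distinct_quadruples)
qed

context
  fixes K :: "(real^2) set" and U :: "(real^2) measure"
  assumes K_sets: "K \<in> sets borel" and K_measure: "emeasure lborel K = 1"
    and U_def: "U = uniform_measure lborel K"
begin

lemma prob_space_U: "prob_space U"
  unfolding U_def by (rule prob_space_uniform_measure) (simp_all add: K_measure)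

lemma sets_U: "sets U = sets borel"
  by (simp add: U_def)

lemma AE_U: "(AE y in lborel. P y) \<Longrightarrow> AE y in U. P y"
  unfolding U_def by (rule AE_uniform_measureI) (auto simp: K_sets)

lemma AE_sample_generic:
  fixes n :: nat
  shows "AE x in Pi\<^sub>M {..<n} (\<lambda>_. U). general_position (x ` {..<n}) \<and> inj_on (\<lambda>i. x i $ 1) {..<n}"
proof -
  interpret prob_space U by (rule prob_space_U)
  interpret product_sigma_finite "\<lambda>_::nat. U" by standard
  have comp: "(\<lambda>x. x m) \<in> borel_measurable (Pi\<^sub>M {..<n} (\<lambda>_. U))" if "m \<in> {..<n}" for m :: nat
    using measurable_component_singleton[OF that, of "\<lambda>_. U"]
    by (simp only: measurable_cong_sets[OF refl sets_U])
  \<comment> \<open>Only coordinate \<open>i\<close> is resampled.\<close>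
  have peel: "AE x in Pi\<^sub>M {..<n} (\<lambda>_. U). P x"
    if "i \<in> {..<n}" "Measurable.pred (Pi\<^sub>M {..<n} (\<lambda>_. U)) P" "\<And>x. AE y in U. P (x(i := y))" for P i
  proof -
    have eq: "insert i ({..<n} - {i}) = {..<n}" using that(1) by blast
    show ?thesis
      by (rule AE_PiM_insertI[of "{..<n} - {i}" i P, unfolded eq]) (use that in auto)
  qed
  have "AE x in Pi\<^sub>M {..<n} (\<lambda>_. U). \<forall>i\<in>{..<n}. \<forall>j\<in>{..<n}. i \<noteq> j \<longrightarrow> x i $ 1 \<noteq> x j $ 1"
  proof (intro AE_finite_allI finite_lessThan)
    fix i j assume ij: "i \<in> {..<n}" "j \<in> {..<n}"
    show "AE x in Pi\<^sub>M {..<n} (\<lambda>_. U). i \<noteq> j \<longrightarrow> x i $ 1 \<noteq> x j $ 1"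
    proof (cases "i = j")
      case False
      have "AE x in Pi\<^sub>M {..<n} (\<lambda>_. U). x i $ 1 \<noteq> x j $ 1"
      proof (rule peel[OF ij(1)])
        show "Measurable.pred (Pi\<^sub>M {..<n} (\<lambda>_. U)) (\<lambda>x. x i $ 1 \<noteq> x j $ 1)"
          using ij by (intro pred_intros_logic pred_eq_borel measurable_vec_nth comp)
        show "AE y in U. (x(i := y)) i $ 1 \<noteq> (x(i := y)) j $ 1" for x :: "nat \<Rightarrow> real^2"
          using AE_U[OF AE_lborel_nth_neq[of 1 "x j $ 1"]] False by simp
      qed
      then show ?thesis by simp
    qed simp
  qed
  moreover have "AE x in Pi\<^sub>M {..<n} (\<lambda>_. U). general_position (x ` {..<n})"
    unfolding general_position_image
  proof (intro AE_finite_allI finite_lessThan)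
    fix i j k assume ijk: "i \<in> {..<n}" "j \<in> {..<n}" "k \<in> {..<n}"
    show "AE x in Pi\<^sub>M {..<n} (\<lambda>_. U).
      x i \<noteq> x j \<longrightarrow> x j \<noteq> x k \<longrightarrow> x i \<noteq> x k \<longrightarrow> orient (x i) (x j) (x k) \<noteq> 0"
    proof (rule peel[OF ijk(3)])
      show "Measurable.pred (Pi\<^sub>M {..<n} (\<lambda>_. U))
          (\<lambda>x. x i \<noteq> x j \<longrightarrow> x j \<noteq> x k \<longrightarrow> x i \<noteq> x k \<longrightarrow> orient (x i) (x j) (x k) \<noteq> 0)"
        using ijk by (intro pred_intros_logic pred_eq_borel measurable_orient comp borel_measurable_const)
      fix x :: "nat \<Rightarrow> real^2"
      let ?P = "\<lambda>x. x i \<noteq> x j \<longrightarrow> x j \<noteq> x k \<longrightarrow> x i \<noteq> x k \<longrightarrow> orient (x i) (x j) (x k) \<noteq> 0"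
      show "AE y in U. ?P (x(k := y))"
      \<comment> \<open>In these cases a premise of the implication fails; otherwise
        \<open>y\<close> only has to avoid the line through two fixed distinct points.\<close>
      proof (cases "i = k \<or> j = k \<or> x i = x j")
        case False
        then show ?thesis using AE_U[OF AE_lborel_orient_nz[of "x i" "x j"]] by auto
      qed auto
    qed
  qed
  ultimately show ?thesis
    by eventually_elim (auto simp: inj_on_def)
qed

text \<open>Linearity over index quadruples: the sample is identically distributed, so all of them
  contribute the same integral.\<close>

lemma expected_holes_eq:
  "expected_holes 4 K n =
    real (n * (n - 1) * (n - 2) * (n - 3)) * enn2real (empty_quad_integral U (n - 4))"
proof -
  let ?M = "Pi\<^sub>M {..<n} (\<lambda>_. U)"
  let ?w = "\<lambda>(i, j, k, l) x. empty_quad_weight ({..<n} - {i, j, k, l}) (x i) (x j) (x k) (x l) x"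
  have comp: "(\<lambda>x. x m) \<in> borel_measurable ?M" if "m \<in> {..<n}" for m :: nat
    using measurable_component_singleton[OF that, of "\<lambda>_. U"]
    by (simp only: measurable_cong_sets[OF refl sets_U])
  have meas: "?w t \<in> borel_measurable ?M" if "t \<in> distinct_quadruples n" for t
    using that by (auto simp: distinct_quadruples_def intro!: measurable_empty_quad_weight comp)
  have int: "(\<integral>\<^sup>+x. ?w t x \<partial>?M) = empty_quad_integral U (n - 4)" if "t \<in> distinct_quadruples n" for t
  proof -
    obtain i j k l where t: "t = (i, j, k, l)" by (cases t)
    let ?R = "{..<n} - {i, j, k, l}"
    have lt: "i < n" "j < n" "k < n" "l < n"
      and ne: "i \<notin> insert j (insert k (insert l ?R))" "j \<notin> insert k (insert l ?R)" "k \<notin> insert l ?R" "l \<notin> ?R"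
      using that by (auto simp: t distinct_quadruples_def)
    have "insert i (insert j (insert k (insert l ?R))) = {..<n}" using lt by auto
    moreover have "card ?R = n - 4" using lt ne by (subst card_Diff_subset) auto
    ultimately show ?thesis
      using nn_integral_empty_quad_weight[OF prob_space_U sets_U _ ne] by (simp add: t)
  qed
  have "(\<integral>\<^sup>+x. ennreal (real (card {H. hole 4 (x ` {..<n}) H})) \<partial>?M)
      = (\<integral>\<^sup>+x. (\<Sum>t\<in>distinct_quadruples n. ?w t x) \<partial>?M)"
  proof (rule nn_integral_cong_AE, use AE_sample_generic in eventually_elim)
    fix x :: "nat \<Rightarrow> real^2"
    assume x: "general_position (x ` {..<n}) \<and> inj_on (\<lambda>i. x i $ 1) {..<n}"
    then have "inj_on (\<lambda>p. p $ 1) (x ` {..<n})" "inj_on x {..<n}"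
      by (auto simp: inj_on_def)
    then show "ennreal (real (card {H. hole 4 (x ` {..<n}) H})) = (\<Sum>t\<in>distinct_quadruples n. ?w t x)"
      using x card_holes_eq_card_quads card_empty_quads_image[of x n]
      by (simp add: case_prod_unfold flip: ennreal_of_nat_eq_real_of_nat)
  qed
  also have "\<dots> = (\<Sum>t\<in>distinct_quadruples n. empty_quad_integral U (n - 4))"
    by (subst nn_integral_sum[OF meas], assumption) (intro sum.cong refl int)
  also have "\<dots> = ennreal (real (n * (n - 1) * (n - 2) * (n - 3))) * empty_quad_integral U (n - 4)"
    by (simp add: card_distinct_quadruples ennreal_of_nat_eq_real_of_nat)
  finally have *: "(\<integral>\<^sup>+x. ennreal (real (card {H. hole 4 (x ` {..<n}) H})) \<partial>?M) = \<dots>" .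
  have "expected_holes 4 K n = enn2real (\<integral>\<^sup>+x. ennreal (real (card {H. hole 4 (x ` {..<n}) H})) \<partial>?M)"
    unfolding expected_holes_def U_def[symmetric]
    by (rule integral_eq_nn_integral[OF measurable_card_holes[OF sets_U]]) simp
  then show ?thesis unfolding * by (simp add: enn2real_mult)
qed

end

section \<open>Affine coordinates along the segment between the extreme points\<close>

text \<open>The factor \<open>2 / (r (q$1 - p$1))\<close> makes the Jacobian \<open>2 / r\<close> and the area of the triangle
  \<open>p\<close>, \<open>q\<close>, \<open>chart r p q z\<close> equal to \<open>\<bar>snd z\<bar> / r\<close>.\<close>

definition chart :: "real \<Rightarrow> real^2 \<Rightarrow> real^2 \<Rightarrow> real \<times> real \<Rightarrow> real^2" where
  "chart r p q z = (\<chi> i. if i = 1 then p$1 + (q$1 - p$1) * fst z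
     else p$2 + (q$2 - p$2) * fst z + 2 / (r * (q$1 - p$1)) * snd z)"

lemma chart_nth [simp]:
  "chart r p q z $ 1 = p$1 + (q$1 - p$1) * fst z"
  "chart r p q z $ 2 = p$2 + (q$2 - p$2) * fst z + 2 / (r * (q$1 - p$1)) * snd z"
  by (simp_all add: chart_def)

lemma measurable_vec2:
  "(\<lambda>z. (\<chi> i. if i = 1 then fst z else snd z) :: real^2) \<in> borel_measurable borel"
proof (intro borel_measurable_continuous_onI continuous_on_vec_lambda)
  show "continuous_on UNIV (\<lambda>z::real \<times> real. if i = 1 then fst z else snd z)" for i :: 2
    by (cases "i = 1") (auto intro!: continuous_intros)
qed

lemma measurable_chart [measurable (raw)]:
  assumes [measurable]: "f \<in> borel_measurable M" "g \<in> borel_measurable M"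
    and h: "h \<in> borel_measurable M"
  shows "(\<lambda>x. chart r (f x) (g x) (h x)) \<in> borel_measurable M"
proof -
  note [measurable] = h[folded borel_prod]
  have "(\<lambda>x. (f x)$1 + ((g x)$1 - (f x)$1) * fst (h x)) \<in> borel_measurable M"
    "(\<lambda>x. (f x)$2 + ((g x)$2 - (f x)$2) * fst (h x) + 2 / (r * ((g x)$1 - (f x)$1)) * snd (h x))
      \<in> borel_measurable M"
    by measurable
  from measurable_compose[OF borel_measurable_Pair[OF this] measurable_vec2] show ?thesis
    unfolding chart_def fst_conv snd_conv .
qed

text \<open>Identifies \<open>real^2\<close> with a product of two lines, which makes Fubini
  available; equality of the measures is checked on boxes.\<close>

lemma nn_integral_vec2:
  fixes f :: "real^2 \<Rightarrow> ennreal"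
  assumes [measurable]: "f \<in> borel_measurable borel"
  shows "(\<integral>\<^sup>+x. f x \<partial>lborel) = (\<integral>\<^sup>+a. \<integral>\<^sup>+b. f (\<chi> i. if i = 1 then a else b) \<partial>lborel \<partial>lborel)"
proof -
  let ?g = "\<lambda>z::real \<times> real. (\<chi> i. if i = 1 then fst z else snd z) :: real^2"
  note [measurable] = measurable_vec2
  have distr: "lborel = distr lborel borel ?g"
  proof (rule lborel_eqI)
    fix l u :: "real^2" assume le: "\<And>b. b \<in> Basis \<Longrightarrow> l \<bullet> b \<le> u \<bullet> b"
    have le': "l$i \<le> u$i" for i using le[of "axis i 1"] by (simp add: inner_axis)
    have "?g -` box l u = box (l$1, l$2) (u$1, u$2)"
      by (auto simp: mem_box_cart forall_2 mem_box Basis_prod_def)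
    then have "emeasure (distr lborel borel ?g) (box l u) = emeasure lborel (box (l$1, l$2) (u$1, u$2))"
      by (subst emeasure_distr) auto
    also have "\<dots> = ennreal ((u$1 - l$1) * (u$2 - l$2))"
      using le' by (subst emeasure_lborel_box) (auto simp: Basis_prod_def prod.union_disjoint)
    also have "(u$1 - l$1) * (u$2 - l$2) = (\<Prod>b\<in>Basis. (u - l) \<bullet> b)"
      by (simp add: Basis_vec_def prod.reindex inner_axis axis_eq_axis UNIV_2)
    finally show "emeasure (distr lborel borel ?g) (box l u) = ennreal (\<Prod>b\<in>Basis. (u - l) \<bullet> b)" .
  qed simp
  have "(\<integral>\<^sup>+x. f x \<partial>lborel) = (\<integral>\<^sup>+x. f x \<partial>distr lborel borel ?g)"
    by (simp only: distr[symmetric])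
  also have "\<dots> = (\<integral>\<^sup>+z. f (?g z) \<partial>lborel)"
    by (rule nn_integral_distr) measurable
  also have "\<dots> = (\<integral>\<^sup>+a. \<integral>\<^sup>+b. f (?g (a, b)) \<partial>lborel \<partial>lborel)"
    unfolding lborel_prod[symmetric]
    by (rule lborel.nn_integral_fst[symmetric]) (simp add: lborel_prod)
  finally show ?thesis unfolding fst_conv snd_conv .
qed

text \<open>The chart is triangular, so two one-dimensional affine substitutions suffice. Their
  factors multiply to 2/r because the horizontal distance cancels.\<close>

lemma nn_integral_chart:
  fixes f :: "real^2 \<Rightarrow> ennreal"
  assumes [measurable]: "f \<in> borel_measurable borel" and r: "0 < r" and pq: "p$1 < q$1"
  shows "(\<integral>\<^sup>+x. f x \<partial>lborel) = ennreal (2 / r) * (\<integral>\<^sup>+z. f (chart r p q z) \<partial>lborel)"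
proof -
  let ?v = "\<lambda>a b. (\<chi> i. if i = 1 then a else b) :: real^2"
  note [measurable] = measurable_vec2
  have vm: "(\<lambda>x. f (?v (g x) (h x))) \<in> borel_measurable M"
    if "g \<in> borel_measurable M" "h \<in> borel_measurable M" for g h and M :: "'b measure"
    using measurable_compose[OF borel_measurable_Pair[OF that] measurable_compose[OF measurable_vec2 assms(1)]]
    unfolding fst_conv snd_conv .
  let ?c = "q$1 - p$1"
  let ?d = "2 / (r * ?c)"
  have c: "?c > 0" "?d > 0" using pq r by auto
  have inner: "(\<integral>\<^sup>+b. f (?v (p$1 + ?c * s) b) \<partial>lborel) =
      ennreal ?d * (\<integral>\<^sup>+v. f (chart r p q (s, v)) \<partial>lborel)" for s
    using c by (subst nn_integral_real_affine[of _ ?d "p$2 + (q$2 - p$2) * s"])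
      (auto simp: vm chart_def cong: if_cong)
  have "(\<integral>\<^sup>+x. f x \<partial>lborel) = (\<integral>\<^sup>+a. \<integral>\<^sup>+b. f (?v a b) \<partial>lborel \<partial>lborel)"
    by (rule nn_integral_vec2) fact
  also have "\<dots> = ennreal ?c * (\<integral>\<^sup>+s. \<integral>\<^sup>+b. f (?v (p$1 + ?c * s) b) \<partial>lborel \<partial>lborel)"
    using c by (subst nn_integral_real_affine[of _ ?c "p$1"])
      (auto intro!: lborel.borel_measurable_nn_integral simp: case_prod_beta' vm)
  also have "\<dots> = ennreal ?c * (\<integral>\<^sup>+s. ennreal ?d * (\<integral>\<^sup>+v. f (chart r p q (s, v)) \<partial>lborel) \<partial>lborel)"
    unfolding inner ..
  also have "(\<integral>\<^sup>+s. ennreal ?d * (\<integral>\<^sup>+v. f (chart r p q (s, v)) \<partial>lborel) \<partial>lborel)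
      = ennreal ?d * (\<integral>\<^sup>+s. (\<integral>\<^sup>+v. f (chart r p q (s, v)) \<partial>lborel) \<partial>lborel)"
    by (rule nn_integral_cmult)
       (auto intro!: lborel.borel_measurable_nn_integral vm simp: case_prod_beta' chart_def)
  also have "(\<integral>\<^sup>+s. (\<integral>\<^sup>+v. f (chart r p q (s, v)) \<partial>lborel) \<partial>lborel) = (\<integral>\<^sup>+z. f (chart r p q z) \<partial>lborel)"
    unfolding lborel_prod[symmetric]
    by (rule lborel.nn_integral_fst, unfold lborel_prod) measurable
  also have "ennreal ?c * (ennreal ?d * (\<integral>\<^sup>+z. f (chart r p q z) \<partial>lborel)) =
      ennreal (2 / r) * (\<integral>\<^sup>+z. f (chart r p q z) \<partial>lborel)"
  proof -
    have "x * (2 / (r * x)) = 2 / r" if "x \<noteq> 0" for x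
      using that by (simp add: field_simps)
    from this[of ?c, OF less_imp_neq[OF c(1), symmetric]] have "?c * ?d = 2 / r" .
    moreover have "ennreal ?c * ennreal ?d = ennreal (?c * ?d)"
      using c by (intro ennreal_mult[symmetric]) auto
    ultimately show ?thesis by (simp only: mult.assoc[symmetric])
  qed
  finally show ?thesis .
qed

text \<open>\<open>quad\<close> in chart coordinates, with \<open>z\<close> for \<open>k\<close> and
  \<open>z'\<close> for \<open>l\<close>. Positive factors have been cancelled, leaving no trace of
  \<open>p\<close>, \<open>q\<close> or \<open>r\<close>.\<close>

definition chart_cone :: "(real \<times> real) \<Rightarrow> (real \<times> real) \<Rightarrow> bool" where
  "chart_cone z z' \<longleftrightarrow>
     0 < fst z \<and> fst z < 1 \<and> 0 < fst z' \<and> fst z' < 1 \<and> snd z' < 0 \<and> 0 < snd z \<or>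
     0 < fst z \<and> fst z < fst z' \<and> fst z' < 1 \<and>
       0 < (fst z * snd z' - fst z' * snd z) * ((1 - fst z') * snd z - (1 - fst z) * snd z')"

text \<open>This is \<open>r\<close> times the area of the quadrilateral only on \<open>chart_cone\<close>.\<close>

definition cone_area :: "(real \<times> real) \<Rightarrow> (real \<times> real) \<Rightarrow> real" where
  "cone_area z z' = (if snd z' < 0 \<and> 0 < snd z then snd z - snd z'
     else \<bar>fst z * snd z' - fst z' * snd z\<bar> + \<bar>snd z'\<bar>)"

lemma orient_chart:
  assumes r: "0 < r" and pq: "p$1 < q$1"
  shows "orient p q (chart r p q z) = 2 / r * snd z"
    "orient p (chart r p q z) (chart r p q z') = 2 / r * (fst z * snd z' - fst z' * snd z)"
    "orient (chart r p q z) (chart r p q z') q = 2 / r * ((1 - fst z') * snd z - (1 - fst z) * snd z')"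
  using assms by (simp_all add: orient_def divide_simps) (simp_all add: algebra_simps)

lemma chart_less:
  assumes "p$1 < q$1"
  shows "p$1 < chart r p q z $ 1 \<longleftrightarrow> 0 < fst z" "chart r p q z $ 1 < q$1 \<longleftrightarrow> fst z < 1"
    "chart r p q z $ 1 < chart r p q z' $ 1 \<longleftrightarrow> fst z < fst z'"
proof -
  have c: "0 < q$1 - p$1" using assms by simp
  show "p$1 < chart r p q z $ 1 \<longleftrightarrow> 0 < fst z"
    using c by (simp add: zero_less_mult_iff)
  have "chart r p q z $ 1 < q$1 \<longleftrightarrow> (q$1 - p$1) * fst z < (q$1 - p$1) * 1" by simp linarith
  then show "chart r p q z $ 1 < q$1 \<longleftrightarrow> fst z < 1"
    using c by (simp only: mult_less_cancel_left_pos)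
  show "chart r p q z $ 1 < chart r p q z' $ 1 \<longleftrightarrow> fst z < fst z'"
    using c by (simp add: mult_less_cancel_left_pos)
qed

lemma opposite_quad_chart:
  assumes "0 < r" "p$1 < q$1"
  shows "opposite_quad p q (chart r p q z) (chart r p q z') \<longleftrightarrow>
    0 < fst z \<and> fst z < 1 \<and> 0 < fst z' \<and> fst z' < 1 \<and> snd z' < 0 \<and> 0 < snd z"
  unfolding opposite_quad_def chart_less[OF assms(2)] orient_chart(1)[OF assms]
  using assms(1) by (simp add: zero_less_mult_iff mult_less_0_iff zero_less_divide_iff divide_less_0_iff)

lemma quad_chart:
  assumes "0 < r" "p$1 < q$1"
  shows "quad p q (chart r p q z) (chart r p q z') \<longleftrightarrow> chart_cone z z'"
proof -
  have pos: "0 < 2 / r * a * (2 / r * b) \<longleftrightarrow> 0 < a * b" for a b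
    using assms(1) by (simp add: zero_less_mult_iff zero_less_divide_iff)
  show ?thesis
    unfolding quad_def chart_cone_def opposite_quad_chart[OF assms] same_quad_def chart_less[OF assms(2)]
      orient_chart(2,3)[OF assms] pos conj_assoc ..
qed

lemma quad_area_chart:
  assumes "0 < r" "p$1 < q$1" "chart_cone z z'"
  shows "quad_area p q (chart r p q z) (chart r p q z') = cone_area z z' / r"
proof -
  \<comment> \<open>Both disjuncts of \<open>chart_cone\<close> contain the range conditions on the
    first coordinates, so the signs of the heights alone decide the type.\<close>
  have opp: "opposite_quad p q (chart r p q z) (chart r p q z') \<longleftrightarrow> snd z' < 0 \<and> 0 < snd z"
    unfolding opposite_quad_chart[OF assms(1,2)] using assms(3) by (auto simp: chart_cone_def)
  have o: "orient p (chart r p q z') (chart r p q z) = - (2 / r * (fst z * snd z' - fst z' * snd z))"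
    "orient p (chart r p q z') q = - (2 / r * snd z')"
    unfolding orient_swap2[of p "chart r p q z'" "chart r p q z"]
      orient_swap2[of p "chart r p q z'" q] orient_chart[OF assms(1,2)]
    by (simp_all only: mult_minus_right[symmetric] minus_diff_eq)
  have a: "\<bar>2 / r * x\<bar> = 2 / r * \<bar>x\<bar>" for x
    using assms(1) by (simp add: abs_mult)
  have half: "(2 / r * x + 2 / r * y) / 2 = (x + y) / r" for x y
    by (simp add: add_divide_distrib)
  show ?thesis
    unfolding quad_area_def cone_area_def opp orient_chart(1)[OF assms(1,2)] o abs_minus_cancel a
    by (auto simp only: half split: if_split) (simp add: abs_if)
qed

lemma measurable_cone [measurable (raw)]:
  assumes "f \<in> borel_measurable M" "g \<in> borel_measurable M"
  shows "Measurable.pred M (\<lambda>x. chart_cone (f x) (g x))"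
proof -
  note [measurable] = assms[folded borel_prod]
  show ?thesis unfolding chart_cone_def by measurable
qed

lemma measurable_cone_area [measurable (raw)]:
  assumes "f \<in> borel_measurable M" "g \<in> borel_measurable M"
  shows "(\<lambda>x. cone_area (f x) (g x)) \<in> borel_measurable M"
proof -
  note [measurable] = assms[folded borel_prod]
  show ?thesis unfolding cone_area_def by measurable
qed

lemma cone_area_nonneg: "0 \<le> cone_area z z'"
  by (auto simp: cone_area_def)

text \<open>The scale \<open>r\<close> and the exponent \<open>m\<close> are independent because
  they will be n and n - 4. \<open>ennreal\<close> cuts off a negative base at 0, so the exponential
  bound needs no restriction on the area.\<close>

definition chart_integral :: "(real^2) set \<Rightarrow> real \<Rightarrow> nat \<Rightarrow> real^2 \<Rightarrow> real^2 \<Rightarrow> ennreal" where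
  "chart_integral K r m p q = (\<integral>\<^sup>+z. \<integral>\<^sup>+z'.
     (if chart_cone z z' \<and> chart r p q z \<in> K \<and> chart r p q z' \<in> K
      then ennreal (1 - cone_area z z' / r) ^ m else 0) \<partial>lborel \<partial>lborel)"

section \<open>The expectation in chart coordinates\<close>

context
  fixes K :: "(real^2) set" and U :: "(real^2) measure"
  assumes K_sets [measurable]: "K \<in> sets borel" and K_measure: "emeasure lborel K = 1"
    and U_def: "U = uniform_measure lborel K" and K_convex: "convex K"
begin

text \<open>Convexity of \<open>K\<close> keeps the region inside \<open>K\<close>; as
  \<open>K\<close> has area 1, hitting probability equals area.\<close>

lemma nn_integral_U_quad_region:
  assumes "quad p q k l" "{p, q, k, l} \<subseteq> K"
  shows "(\<integral>\<^sup>+y. (if quad_region p q k l y then 0 else 1) \<partial>U) = ennreal (1 - quad_area p q k l)"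
proof -
  interpret prob_space U by (rule prob_space_U[OF K_sets K_measure U_def])
  let ?R = "{y. quad_region p q k l y}"
  have R: "?R \<in> sets borel"
  proof -
    have "Measurable.pred borel (\<lambda>y. quad_region p q k l y)"
      by (intro measurable_quad_region borel_measurable_const measurable_ident_sets refl)
    then show ?thesis by (simp add: pred_def)
  qed
  have sub: "?R \<subseteq> K"
  proof
    fix y assume "y \<in> ?R"
    then have "y \<in> convex hull {p, q, k, l}" by (simp add: quad_region_subset_hull)
    moreover have "convex hull {p, q, k, l} \<subseteq> K" using assms(2) K_convex by (rule hull_minimal)
    ultimately show "y \<in> K" by (rule rev_subsetD)
  qed
  have "emeasure U ?R = emeasure lborel (K \<inter> ?R) / emeasure lborel K"
    unfolding U_def using R K_sets by (intro emeasure_uniform_measure) auto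
  also have "K \<inter> ?R = ?R" using sub by blast
  finally have UR: "emeasure U ?R = ennreal (quad_area p q k l)"
    by (simp add: K_measure emeasure_quad_region[OF assms(1)] divide_ennreal_def)
  have sp: "space U = UNIV" and sU: "sets U = sets borel" by (simp_all add: U_def)
  have "(\<integral>\<^sup>+y. (if quad_region p q k l y then 0 else 1) \<partial>U) = (\<integral>\<^sup>+y. indicator (space U - ?R) y \<partial>U)"
    by (intro nn_integral_cong) (auto simp: sp)
  also have "\<dots> = emeasure U (space U - ?R)"
    using R by (intro nn_integral_indicator) (auto simp: sp sU)
  also have "\<dots> = 1 - emeasure U ?R"
    using R emeasure_space_1 by (subst emeasure_compl) (auto simp: sU)
  finally show ?thesis
    unfolding UR using quad_area_nonneg by (simp add: ennreal_minus flip: ennreal_1)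
qed

lemma nn_integral_U:
  "f \<in> borel_measurable borel \<Longrightarrow> (\<integral>\<^sup>+x. f x \<partial>U) = (\<integral>\<^sup>+x. f x * indicator K x \<partial>lborel)"
  unfolding U_def using K_sets by (subst nn_integral_uniform_measure) (auto simp: K_measure divide_ennreal_def)

lemma AE_U_K: "AE x in U. x \<in> K"
  unfolding U_def using K_sets by (intro AE_uniform_measureI) auto

lemma measurable_empty_quad:
  assumes p: "p \<in> borel_measurable M" and q: "q \<in> borel_measurable M"
    and k: "k \<in> borel_measurable M" and l: "l \<in> borel_measurable M"
  shows "(\<lambda>x. if quad (p x) (q x) (k x) (l x) \<and> k x \<in> K \<and> l x \<in> K
    then ennreal (1 - quad_area (p x) (q x) (k x) (l x)) ^ m else 0) \<in> borel_measurable M"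
proof -
  have "Measurable.pred M (\<lambda>x. k x \<in> K)" "Measurable.pred M (\<lambda>x. l x \<in> K)"
    using k l K_sets by (simp_all add: pred_sets2)
  note [measurable] = this measurable_quad[OF assms] measurable_quad_area[OF assms]
  show ?thesis by measurable
qed

text \<open>Only \<open>k\<close> and \<open>l\<close> will be substituted, so only their integrals
  pass to Lebesgue measure. \<open>p\<close> and \<open>q\<close> stay under the probability
  measure, where a constant is an integrable bound.\<close>

lemma empty_quad_integral_eq:
  "empty_quad_integral U m = (\<integral>\<^sup>+p. \<integral>\<^sup>+q. \<integral>\<^sup>+k. \<integral>\<^sup>+l.
     (if quad p q k l \<and> k \<in> K \<and> l \<in> K then ennreal (1 - quad_area p q k l) ^ m else 0) \<partial>lborel \<partial>lborel \<partial>U \<partial>U)"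
  unfolding empty_quad_integral_def
proof (rule nn_integral_cong_AE, use AE_U_K in eventually_elim, rule nn_integral_cong_AE, use AE_U_K in eventually_elim)
  fix p q assume pq: "p \<in> K" "q \<in> K"
  let ?g = "\<lambda>k l. (if quad p q k l \<and> k \<in> K \<and> l \<in> K then ennreal (1 - quad_area p q k l) ^ m else 0)"
  have "(\<integral>\<^sup>+k. \<integral>\<^sup>+l. (if quad p q k l then (\<integral>\<^sup>+y. (if quad_region p q k l y then 0 else 1) \<partial>U) ^ m else 0) \<partial>U \<partial>U)
      = (\<integral>\<^sup>+k. \<integral>\<^sup>+l. ?g k l \<partial>U \<partial>U)"
  proof (rule nn_integral_cong_AE, use AE_U_K in eventually_elim, rule nn_integral_cong_AE, use AE_U_K in eventually_elim)
    fix k l assume "k \<in> K" "l \<in> K"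
    then show "(if quad p q k l then (\<integral>\<^sup>+y. (if quad_region p q k l y then 0 else 1) \<partial>U) ^ m else 0) = ?g k l"
      using pq nn_integral_U_quad_region[of p q k l] by simp
  qed
  also have "\<dots> = (\<integral>\<^sup>+k. (\<integral>\<^sup>+l. ?g k l * indicator K l \<partial>lborel) \<partial>U)"
    by (intro nn_integral_cong nn_integral_U measurable_empty_quad borel_measurable_const
        measurable_ident_sets refl)
  also have "\<dots> = (\<integral>\<^sup>+k. (\<integral>\<^sup>+l. ?g k l * indicator K l \<partial>lborel) * indicator K k \<partial>lborel)"
  proof (rule nn_integral_U, rule lborel.borel_measurable_nn_integral)
    show "(\<lambda>(k, l). ?g k l * indicator K l) \<in> borel_measurable (borel \<Otimes>\<^sub>M lborel)"
      unfolding case_prod_beta'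
      by (intro borel_measurable_times_ennreal measurable_empty_quad measurable_compose[OF measurable_snd] ) measurable
  qed
  also have "\<dots> = (\<integral>\<^sup>+k. \<integral>\<^sup>+l. ?g k l \<partial>lborel \<partial>lborel)"
  proof (rule nn_integral_cong)
    fix k
    have "(\<integral>\<^sup>+l. ?g k l * indicator K l \<partial>lborel) = (\<integral>\<^sup>+l. ?g k l \<partial>lborel)"
      by (intro nn_integral_cong) (auto simp: indicator_def)
    moreover have "(\<integral>\<^sup>+l. ?g k l \<partial>lborel) * indicator K k = (\<integral>\<^sup>+l. ?g k l \<partial>lborel)"
      by (cases "k \<in> K") auto
    ultimately show "(\<integral>\<^sup>+l. ?g k l * indicator K l \<partial>lborel) * indicator K k = (\<integral>\<^sup>+l. ?g k l \<partial>lborel)"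
      by simp
  qed
  finally show "(\<integral>\<^sup>+k. \<integral>\<^sup>+l. (if quad p q k l then (\<integral>\<^sup>+y. (if quad_region p q k l y then 0 else 1) \<partial>U) ^ m else 0) \<partial>U \<partial>U)
      = (\<integral>\<^sup>+k. \<integral>\<^sup>+l. ?g k l \<partial>lborel \<partial>lborel)" .
qed

lemma lborel_integral_eq_chart_integral:
  assumes r: "0 < r" and pq: "p$1 < q$1"
  shows "(\<integral>\<^sup>+k. \<integral>\<^sup>+l. (if quad p q k l \<and> k \<in> K \<and> l \<in> K then ennreal (1 - quad_area p q k l) ^ m else 0)
      \<partial>lborel \<partial>lborel) = ennreal (4 / r\<^sup>2) * chart_integral K r m p q"
proof -
  let ?g = "\<lambda>k l. (if quad p q k l \<and> k \<in> K \<and> l \<in> K then ennreal (1 - quad_area p q k l) ^ m else 0)"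
  have "(\<integral>\<^sup>+k. \<integral>\<^sup>+l. ?g k l \<partial>lborel \<partial>lborel)
      = ennreal (2 / r) * (\<integral>\<^sup>+z. (\<integral>\<^sup>+l. ?g (chart r p q z) l \<partial>lborel) \<partial>lborel)"
    by (rule nn_integral_chart[OF _ r pq]) measurable
  also have "\<dots> = ennreal (2 / r) * (\<integral>\<^sup>+z. ennreal (2 / r) * (\<integral>\<^sup>+z'. ?g (chart r p q z) (chart r p q z') \<partial>lborel) \<partial>lborel)"
    by (intro arg_cong[where f="\<lambda>x. ennreal (2 / r) * x"] nn_integral_cong nn_integral_chart[OF _ r pq]) measurable
  also have "\<dots> = ennreal (2 / r) * (ennreal (2 / r) * (\<integral>\<^sup>+z. \<integral>\<^sup>+z'. ?g (chart r p q z) (chart r p q z') \<partial>lborel \<partial>lborel))"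
    by (subst nn_integral_cmult) measurable
  also have "(\<integral>\<^sup>+z. \<integral>\<^sup>+z'. ?g (chart r p q z) (chart r p q z') \<partial>lborel \<partial>lborel) = chart_integral K r m p q"
    unfolding chart_integral_def
    by (intro nn_integral_cong) (auto simp: quad_chart[OF r pq] quad_area_chart[OF r pq])
  also have "ennreal (2 / r) * (ennreal (2 / r) * chart_integral K r m p q) = ennreal (4 / r\<^sup>2) * chart_integral K r m p q"
    using r by (simp add: mult.assoc[symmetric] power2_eq_square flip: ennreal_mult)
  finally show ?thesis .
qed

lemma measurable_chart_integral:
  "(\<lambda>x. chart_integral K r m (fst x) (snd x)) \<in> borel_measurable (borel \<Otimes>\<^sub>M borel)"
  unfolding chart_integral_def by measurable

lemma empty_quad_integral_eq_chart_integral: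
  assumes r: "0 < r"
  shows "empty_quad_integral U m =
    ennreal (4 / r\<^sup>2) * (\<integral>\<^sup>+x. (if fst x $ 1 < snd x $ 1 then chart_integral K r m (fst x) (snd x) else 0) \<partial>(U \<Otimes>\<^sub>M U))"
proof -
  interpret prob_space U by (rule prob_space_U[OF K_sets K_measure U_def])
  have sU [measurable_cong]: "sets U = sets borel" by (simp add: U_def)
  let ?h = "\<lambda>p q. if p$1 < q$1 then chart_integral K r m p q else 0"
  have [measurable]: "(\<lambda>x. ?h (fst x) (snd x)) \<in> borel_measurable (U \<Otimes>\<^sub>M U)"
  proof -
    have "(\<lambda>x. chart_integral K r m (fst x) (snd x)) \<in> borel_measurable (U \<Otimes>\<^sub>M U)"
      using measurable_chart_integral by (simp add: measurable_cong_sets[OF sets_pair_measure_cong[OF sU sU] refl])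
    then show ?thesis by measurable
  qed
  have "empty_quad_integral U m = (\<integral>\<^sup>+p. \<integral>\<^sup>+q. ennreal (4 / r\<^sup>2) * ?h p q \<partial>U \<partial>U)"
    unfolding empty_quad_integral_eq
  proof (intro nn_integral_cong)
    fix p q
    show "(\<integral>\<^sup>+k. \<integral>\<^sup>+l. (if quad p q k l \<and> k \<in> K \<and> l \<in> K then ennreal (1 - quad_area p q k l) ^ m else 0)
      \<partial>lborel \<partial>lborel) = ennreal (4 / r\<^sup>2) * ?h p q"
    proof (cases "p$1 < q$1")
      case True
      then show ?thesis by (simp add: lborel_integral_eq_chart_integral[OF r])
    next
      case False
      then have "\<not> quad p q k l" for k l using quad_less[of p q k l] by auto
      then show ?thesis using False by simp
    qed
  qed
  also have "\<dots> = (\<integral>\<^sup>+x. ennreal (4 / r\<^sup>2) * ?h (fst x) (snd x) \<partial>(U \<Otimes>\<^sub>M U))"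
    using nn_integral_fst[of "\<lambda>x. ennreal (4 / r\<^sup>2) * ?h (fst x) (snd x)" U]
    unfolding fst_conv snd_conv by measurable
  also have "\<dots> = ennreal (4 / r\<^sup>2) * (\<integral>\<^sup>+x. ?h (fst x) (snd x) \<partial>(U \<Otimes>\<^sub>M U))"
    by (rule nn_integral_cmult) measurable
  finally show ?thesis .
qed

end

section \<open>The cone integral\<close>

lemma nn_integral_FTC_Ioo:
  fixes f F :: "real \<Rightarrow> real"
  assumes [measurable]: "f \<in> borel_measurable borel"
    and "\<And>x. x \<in> {a..b} \<Longrightarrow> (F has_real_derivative f x) (at x)" "\<And>x. x \<in> {a..b} \<Longrightarrow> 0 \<le> f x" "a \<le> b"
  shows "(\<integral>\<^sup>+x. (if a < x \<and> x < b then ennreal (f x) else 0) \<partial>lborel) = ennreal (F b - F a)"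
proof -
  have "AE x in lborel. (if a < x \<and> x < b then ennreal (f x) else 0) = ennreal (f x) * indicator {a..b} x"
    using AE_lborel_singleton[of a] AE_lborel_singleton[of b]
    by eventually_elim (auto simp: indicator_def)
  then show ?thesis
    using nn_integral_FTC_Icc[OF assms] by (subst nn_integral_cong_AE) auto
qed

lemma nn_integral_FTC_Ioi:
  fixes f F :: "real \<Rightarrow> real"
  assumes [measurable]: "f \<in> borel_measurable borel"
    and "\<And>x. a \<le> x \<Longrightarrow> (F has_real_derivative f x) (at x)" "\<And>x. a \<le> x \<Longrightarrow> 0 \<le> f x" "(F \<longlongrightarrow> T) at_top"
  shows "(\<integral>\<^sup>+x. (if a < x then ennreal (f x) else 0) \<partial>lborel) = ennreal (T - F a)"
proof -
  have "AE x in lborel. (if a < x then ennreal (f x) else 0) = ennreal (f x) * indicator {a..} x"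
    using AE_lborel_singleton[of a] by eventually_elim (auto simp: indicator_def)
  then show ?thesis
    using nn_integral_FTC_atLeast[OF assms] by (subst nn_integral_cong_AE) auto
qed

lemma tendsto_exp_neg: "0 < (c::real) \<Longrightarrow> ((\<lambda>x. exp (- (c * x))) \<longlongrightarrow> 0) at_top"
  by real_asymp

lemma nn_integral_exp_Ioi:
  assumes "0 < c"
  shows "(\<integral>\<^sup>+x. (if 0 < x then ennreal (exp (- (c * x))) else 0) \<partial>lborel) = ennreal (1 / c)"
proof -
  have "((\<lambda>x. - exp (- (c * x)) / c) \<longlongrightarrow> - 0 / c) at_top"
    by (intro tendsto_intros tendsto_exp_neg assms) (use assms in auto)
  then have "(\<integral>\<^sup>+x. (if 0 < x then ennreal (exp (- (c * x))) else 0) \<partial>lborel)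
      = ennreal (0 - (- exp (- (c * 0)) / c))"
    using assms by (intro nn_integral_FTC_Ioi) (auto intro!: derivative_eq_intros)
  then show ?thesis by simp
qed

lemma nn_integral_uminus:
  fixes f :: "real \<Rightarrow> ennreal"
  assumes "f \<in> borel_measurable borel"
  shows "(\<integral>\<^sup>+x. f (- x) \<partial>lborel) = (\<integral>\<^sup>+x. f x \<partial>lborel)"
  using nn_integral_real_affine[OF assms, of "-1" 0] by simp

text \<open>The exponential factorises into two one-dimensional ones.\<close>

lemma opposite_cone_integral:
  assumes c: "0 < c"
  shows "(\<integral>\<^sup>+v. \<integral>\<^sup>+w. (if w < 0 \<and> 0 < v then ennreal (exp (- (c * (v - w)))) else 0) \<partial>lborel \<partial>lborel)
    = ennreal (1 / c\<^sup>2)"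
proof -
  let ?e = "\<lambda>x. if 0 < x then ennreal (exp (- (c * x))) else 0"
  have "(\<integral>\<^sup>+w. (if w < 0 \<and> 0 < v then ennreal (exp (- (c * (v - w)))) else 0) \<partial>lborel) = ?e v * ennreal (1 / c)" for v
  proof -
    have "(\<integral>\<^sup>+w. (if w < 0 \<and> 0 < v then ennreal (exp (- (c * (v - w)))) else 0) \<partial>lborel)
        = (\<integral>\<^sup>+w. ?e v * ?e (- w) \<partial>lborel)"
      by (intro nn_integral_cong) (auto simp: exp_add[symmetric] algebra_simps simp flip: ennreal_mult)
    also have "\<dots> = ?e v * (\<integral>\<^sup>+w. ?e (- w) \<partial>lborel)"
      by (rule nn_integral_cmult) measurable
    also have "(\<integral>\<^sup>+w. ?e (- w) \<partial>lborel) = (\<integral>\<^sup>+w. ?e w \<partial>lborel)"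
      by (rule nn_integral_uminus) measurable
    finally show ?thesis by (simp only: nn_integral_exp_Ioi[OF c])
  qed
  then have "(\<integral>\<^sup>+v. \<integral>\<^sup>+w. (if w < 0 \<and> 0 < v then ennreal (exp (- (c * (v - w)))) else 0) \<partial>lborel \<partial>lborel)
      = (\<integral>\<^sup>+v. ?e v * ennreal (1 / c) \<partial>lborel)"
    by (simp only:)
  also have "\<dots> = ennreal (1 / c) * ennreal (1 / c)"
    by (subst nn_integral_multc) (measurable, simp only: nn_integral_exp_Ioi[OF c])
  also have "\<dots> = ennreal (1 / c\<^sup>2)"
    using c by (simp add: power2_eq_square flip: ennreal_mult)
  finally show ?thesis .
qed

text \<open>For fixed \<open>v > 0\<close> the height \<open>w\<close> runs through an interval, and
  integrating over it leaves a difference of two exponentials in \<open>v\<close>.\<close>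

lemma same_cone_integral:
  assumes c: "0 < c" and st: "0 < s" "s < t" "t < 1"
  shows "(\<integral>\<^sup>+v. \<integral>\<^sup>+w. (if 0 < v \<and> (1 - t) * v < (1 - s) * w \<and> s * w < t * v
      then ennreal (exp (- (c * (t * v + (1 - s) * w)))) else 0) \<partial>lborel \<partial>lborel)
    = ennreal ((t - s) / (t * (1 - s)) / c\<^sup>2)"
proof -
  let ?h = "\<lambda>v. (exp (- (c * v)) - exp (- (c * (t / s) * v))) / (c * (1 - s))"
  have cs: "0 < c * (1 - s)" using c st by simp
  have ts: "1 \<le> t / s" using st by simp
  have inner: "(\<integral>\<^sup>+w. (if 0 < v \<and> (1 - t) * v < (1 - s) * w \<and> s * w < t * v
      then ennreal (exp (- (c * (t * v + (1 - s) * w)))) else 0) \<partial>lborel) = (if 0 < v then ennreal (?h v) else 0)" for v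
  proof (cases "0 < v")
    case True
    let ?a = "(1 - t) * v / (1 - s)" and ?b = "t * v / s"
    let ?F = "\<lambda>w. - exp (- (c * (t * v + (1 - s) * w))) / (c * (1 - s))"
    have "(1 - t) / (1 - s) \<le> t / s" using st by (simp add: divide_simps mult_mono') (simp add: algebra_simps)
    then have ab: "?a \<le> ?b" using True by (metis mult_right_mono less_imp_le times_divide_eq_left)
    have "(\<integral>\<^sup>+w. (if 0 < v \<and> (1 - t) * v < (1 - s) * w \<and> s * w < t * v
        then ennreal (exp (- (c * (t * v + (1 - s) * w)))) else 0) \<partial>lborel)
      = (\<integral>\<^sup>+w. (if ?a < w \<and> w < ?b then ennreal (exp (- (c * (t * v + (1 - s) * w)))) else 0) \<partial>lborel)"
      using True st by (intro nn_integral_cong if_cong refl) (auto simp: pos_divide_less_eq pos_less_divide_eq mult.commute)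
    also have "\<dots> = ennreal (?F ?b - ?F ?a)"
      using cs ab c st by (intro nn_integral_FTC_Ioo) (auto intro!: derivative_eq_intros)
    also have "?F ?b - ?F ?a = ?h v"
    proof -
      \<comment> \<open>At the lower end \<open>l\<close> lies on \<open>kq\<close> and the
        quadrilateral collapses to the triangle \<open>pqk\<close>, of rescaled area
        \<open>v\<close>. At the upper end \<open>k\<close> lies on \<open>pl\<close>, leaving
        \<open>pql\<close>, of rescaled area \<open>t / s * v\<close>.\<close>
      have "t * v + (1 - s) * ?a = v" using st by (simp add: field_simps)
      moreover have "t * v + (1 - s) * ?b = t / s * v" using st by (simp add: field_simps)
      ultimately show ?thesis by (simp add: diff_divide_distrib mult.assoc)
    qed
    finally show ?thesis using True by simp
  qed simp
  let ?G = "\<lambda>v. (- exp (- (c * v)) / c + s / (c * t) * exp (- (c * (t / s) * v))) / (c * (1 - s))"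
  have "(?G \<longlongrightarrow> (- 0 / c + s / (c * t) * 0) / (c * (1 - s))) at_top"
    by (intro tendsto_intros tendsto_exp_neg) (use c cs st in auto)
  then have lim: "(?G \<longlongrightarrow> 0) at_top" by simp
  have "(\<integral>\<^sup>+v. (if 0 < v then ennreal (?h v) else 0) \<partial>lborel) = ennreal (0 - ?G 0)"
  proof (rule nn_integral_FTC_Ioi[OF _ _ _ lim])
    fix v :: real assume v: "0 \<le> v"
    show "(?G has_real_derivative ?h v) (at v)"
      using c cs st by (auto intro!: derivative_eq_intros)
    have "c * 1 * v \<le> c * (t / s) * v"
      using v c ts by (intro mult_right_mono mult_left_mono) auto
    then show "0 \<le> ?h v" using cs by simp
  qed simp
  also have "0 - ?G 0 = (t - s) / (t * (1 - s)) / c\<^sup>2"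
    using c st by (simp add: power2_eq_square divide_simps)
  finally show ?thesis unfolding inner .
qed

lemma same_cone_integral_neg:
  assumes c: "0 < c" and st: "0 < s" "s < t" "t < 1"
  shows "(\<integral>\<^sup>+v. \<integral>\<^sup>+w. (if 0 < - v \<and> (1 - t) * (- v) < (1 - s) * (- w) \<and> s * (- w) < t * (- v)
      then ennreal (exp (- (c * (t * (- v) + (1 - s) * (- w))))) else 0) \<partial>lborel \<partial>lborel)
    = ennreal ((t - s) / (t * (1 - s)) / c\<^sup>2)"
proof -
  let ?f = "\<lambda>v w. (if 0 < v \<and> (1 - t) * v < (1 - s) * w \<and> s * w < t * v
      then ennreal (exp (- (c * (t * v + (1 - s) * w)))) else 0)"
  have "(\<integral>\<^sup>+v. \<integral>\<^sup>+w. ?f (- v) (- w) \<partial>lborel \<partial>lborel) = (\<integral>\<^sup>+v. \<integral>\<^sup>+w. ?f (- v) w \<partial>lborel \<partial>lborel)"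
    by (intro nn_integral_cong nn_integral_uminus[where f="?f (- _)"]) measurable
  also have "\<dots> = (\<integral>\<^sup>+v. \<integral>\<^sup>+w. ?f v w \<partial>lborel \<partial>lborel)"
    by (rule nn_integral_uminus[where f="\<lambda>v. \<integral>\<^sup>+w. ?f v w \<partial>lborel"]) measurable
  finally show ?thesis using same_cone_integral[OF assms] by simp
qed

section \<open>The series for 2 - pi^2/6 and the integral that it evaluates\<close>

lemma sums_reciprocals:
  "(\<lambda>j. 1 / (real (j + 1) * (real (j + 2))\<^sup>2)) sums (2 - pi\<^sup>2 / 6)"
proof -
  have "(\<lambda>j. 1 / (real j + 1)\<^sup>2) sums (pi\<^sup>2 / 6)"
    using inverse_squares_sums by (simp add: add.commute)
  from sums_split_initial_segment[OF this, of 1]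
  have sq: "(\<lambda>j. 1 / (real j + 2)\<^sup>2) sums (pi\<^sup>2 / 6 - 1)"
    by (simp add: add.commute add.left_commute)
  have "(\<lambda>j. 1 / (real j + 1)) \<longlonglongrightarrow> 0" by real_asymp
  from telescope_sums'[OF this] have "(\<lambda>j. 1 / (real j + 1) - 1 / (real j + 2)) sums 1"
    by (simp add: add.commute add.left_commute)
  from sums_diff[OF this sq]
  have "(\<lambda>j. 1 / (real j + 1) - 1 / (real j + 2) - 1 / (real j + 2)\<^sup>2) sums (2 - pi\<^sup>2 / 6)"
    by (simp add: algebra_simps)
  \<comment> \<open>Partial fractions: a telescoping part with sum 1, minus the Basel series without
    its first term.\<close>
  moreover have "1 / (real j + 1) - 1 / (real j + 2) - 1 / (real j + 2)\<^sup>2 = 1 / (real (j + 1) * (real (j + 2))\<^sup>2)" for j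
  proof -
    have "1 / x - 1 / (x + 1) - 1 / (x + 1)\<^sup>2 = 1 / (x * (x + 1)\<^sup>2)" if "0 < x" for x :: real
      using that by (simp add: divide_simps power2_eq_square)
    from this[of "real j + 1"] show ?thesis by (simp add: add.commute add.left_commute)
  qed
  ultimately show ?thesis by simp
qed

text \<open>Lets this number pass through \<open>ennreal\<close> without being truncated to
  0.\<close>

lemma two_minus_pi_nonneg: "0 \<le> 2 - pi\<^sup>2 / 6"
  using sums_reciprocals by (rule sums_le[OF _ sums_zero, rotated]) simp

lemma DERIV_power_pred: "n = m + 1 \<Longrightarrow> ((\<lambda>x::real. x ^ n) has_real_derivative real n * x ^ m) (at x)"
  using DERIV_pow[of n x] by simp

lemma chain_integral_power:
  assumes "0 < t" "t < 1"
  shows "(\<integral>\<^sup>+s. (if 0 < s \<and> s < t then ennreal ((1 - s / t) * s ^ j) else 0) \<partial>lborel)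
    = ennreal (t ^ (j + 1) / (real (j + 1) * real (j + 2)))"
proof -
  let ?F = "\<lambda>s. s ^ (j + 1) / real (j + 1) - s ^ (j + 2) / (real (j + 2) * t)"
  have "(\<integral>\<^sup>+s. (if 0 < s \<and> s < t then ennreal ((1 - s / t) * s ^ j) else 0) \<partial>lborel) = ennreal (?F t - ?F 0)"
  proof (rule nn_integral_FTC_Ioo)
    fix s assume s: "s \<in> {0..t}"
    have "((\<lambda>s. s ^ (j + 1) / real (j + 1)) has_real_derivative real (j + 1) * s ^ j / real (j + 1)) (at s)"
      by (intro DERIV_cdivide DERIV_power_pred) simp
    moreover have "((\<lambda>s. s ^ (j + 2) / (real (j + 2) * t)) has_real_derivative
        real (j + 2) * s ^ (j + 1) / (real (j + 2) * t)) (at s)"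
      by (intro DERIV_cdivide DERIV_power_pred) simp
    ultimately have "(?F has_real_derivative
        real (j + 1) * s ^ j / real (j + 1) - real (j + 2) * s ^ (j + 1) / (real (j + 2) * t)) (at s)"
      by (rule DERIV_diff)
    also have "real (j + 1) * s ^ j / real (j + 1) - real (j + 2) * s ^ (j + 1) / (real (j + 2) * t)
        = (1 - s / t) * s ^ j"
    proof -
      have "real (j + 1) * s ^ j / real (j + 1) = s ^ j"
        by (rule nonzero_mult_div_cancel_left) simp
      moreover have "real (j + 2) * s ^ (j + 1) / (real (j + 2) * t) = s ^ (j + 1) / t"
        by (rule mult_divide_mult_cancel_left) simp
      ultimately show ?thesis by (simp add: algebra_simps)
    qed
    finally show "(?F has_real_derivative (1 - s / t) * s ^ j) (at s)" .
    show "0 \<le> (1 - s / t) * s ^ j" using s assms by simp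
  qed (use assms in auto)
  also have "?F t - ?F 0 = t ^ (j + 1) / (real (j + 1) * real (j + 2))"
  proof -
    have "x / a - x / (a + 1) = x / (a * (a + 1))" if "0 < a" for x a :: real
      using that by (simp add: divide_simps) (simp add: algebra_simps)
    from this[of "real (j + 1)" "t ^ (j + 1)"] show ?thesis
      using assms by (simp add: add.commute)
  qed
  finally show ?thesis .
qed

lemma unit_interval_integral_power:
  "(\<integral>\<^sup>+t. (if 0 < t \<and> t < 1 then ennreal (t ^ (j + 1) / (real (j + 1) * real (j + 2))) else 0) \<partial>lborel)
    = ennreal (1 / (real (j + 1) * (real (j + 2))\<^sup>2))"
proof -
  let ?F = "\<lambda>t::real. t ^ (j + 2) / real (j + 2) / (real (j + 1) * real (j + 2))"
  have "(\<integral>\<^sup>+t. (if 0 < t \<and> t < 1 then ennreal (t ^ (j + 1) / (real (j + 1) * real (j + 2))) else 0) \<partial>lborel)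
    = ennreal (?F 1 - ?F 0)"
  proof (rule nn_integral_FTC_Ioo)
    fix t :: real
    have "((\<lambda>t. t ^ (j + 2)) has_real_derivative real (j + 2) * t ^ (j + 1)) (at t)"
      by (rule DERIV_power_pred) simp
    then have "(?F has_real_derivative real (j + 2) * t ^ (j + 1) / real (j + 2) / (real (j + 1) * real (j + 2))) (at t)"
      by (intro DERIV_cdivide)
    moreover have "real (j + 2) * t ^ (j + 1) / real (j + 2) = t ^ (j + 1)"
      by (rule nonzero_mult_div_cancel_left) simp
    ultimately show "(?F has_real_derivative t ^ (j + 1) / (real (j + 1) * real (j + 2))) (at t)"
      by (simp only:)
  qed auto
  also have "?F 1 - ?F 0 = 1 / (real (j + 1) * (real (j + 2))\<^sup>2)"
    by (simp add: power2_eq_square mult_ac)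
  finally show ?thesis .
qed

text \<open>Expanding \<open>1 / (1 - s)\<close> as a geometric series makes every term of the double integral elementary.\<close>

lemma same_cone_density_integral:
  "(\<integral>\<^sup>+s. \<integral>\<^sup>+t. (if 0 < s \<and> s < t \<and> t < 1 then ennreal ((t - s) / (t * (1 - s))) else 0) \<partial>lborel \<partial>lborel)
    = ennreal (2 - pi\<^sup>2 / 6)"
proof -
  let ?f = "\<lambda>j s t. (if 0 < s \<and> s < t \<and> t < 1 then ennreal ((1 - s / t) * s ^ j) else 0)"
  have series: "(if 0 < s \<and> s < t \<and> t < 1 then ennreal ((t - s) / (t * (1 - s))) else 0) = (\<Sum>j. ?f j s t)" for s t :: real
  proof (cases "0 < s \<and> s < t \<and> t < 1")
    case True
    then have "(\<lambda>j. (1 - s / t) * s ^ j) sums ((1 - s / t) * (1 / (1 - s)))"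
      by (intro sums_mult geometric_sums) auto
    moreover have "(1 - s / t) * (1 / (1 - s)) = (t - s) / (t * (1 - s))"
      using True by (simp add: divide_simps)
    moreover have "0 \<le> (1 - s / t) * s ^ j" for j using True by simp
    ultimately have "(\<Sum>j. ennreal ((1 - s / t) * s ^ j)) = ennreal ((t - s) / (t * (1 - s)))"
      by (intro suminf_ennreal_eq) auto
    then show ?thesis using True by simp
  next
    case False
    show ?thesis by (simp only: if_not_P[OF False] suminf_zero)
  qed
  \<comment> \<open>With \<open>s\<close> innermost every term integrates to a power of
    \<open>t\<close>; nonnegativity justifies exchanging the integrals and the series.\<close>
  have "(\<integral>\<^sup>+s. \<integral>\<^sup>+t. (\<Sum>j. ?f j s t) \<partial>lborel \<partial>lborel) = (\<integral>\<^sup>+t. \<integral>\<^sup>+s. (\<Sum>j. ?f j s t) \<partial>lborel \<partial>lborel)"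
    by (rule lborel_pair.Fubini') measurable
  also have "\<dots> = (\<integral>\<^sup>+t. (\<Sum>j. \<integral>\<^sup>+s. ?f j s t \<partial>lborel) \<partial>lborel)"
    by (intro nn_integral_cong nn_integral_suminf) measurable
  also have "\<dots> = (\<integral>\<^sup>+t. (\<Sum>j. (if 0 < t \<and> t < 1 then ennreal (t ^ (j + 1) / (real (j + 1) * real (j + 2))) else 0)) \<partial>lborel)"
  proof (intro nn_integral_cong suminf_cong)
    fix t :: real and j
    show "(\<integral>\<^sup>+s. ?f j s t \<partial>lborel) = (if 0 < t \<and> t < 1 then ennreal (t ^ (j + 1) / (real (j + 1) * real (j + 2))) else 0)"
    proof (cases "0 < t \<and> t < 1")
      case True
      then have "?f j s t = (if 0 < s \<and> s < t then ennreal ((1 - s / t) * s ^ j) else 0)" for s by simp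
      then show ?thesis using True chain_integral_power[of t j] by (simp only: simp_thms if_True)
    next
      case False
      then have "?f j s t = 0" for s by auto
      then show ?thesis using False by (simp only: nn_integral_const mult_zero_left if_False)
    qed
  qed
  also have "\<dots> = (\<Sum>j. \<integral>\<^sup>+t. (if 0 < t \<and> t < 1 then ennreal (t ^ (j + 1) / (real (j + 1) * real (j + 2))) else 0) \<partial>lborel)"
    by (rule nn_integral_suminf) measurable
  also have "\<dots> = (\<Sum>j. ennreal (1 / (real (j + 1) * (real (j + 2))\<^sup>2)))"
    by (simp only: unit_interval_integral_power)
  also have "\<dots> = ennreal (2 - pi\<^sup>2 / 6)"
    by (intro suminf_ennreal_eq sums_reciprocals) simp
  finally show ?thesis unfolding series .
qed

section \<open>Decomposition and total mass of the cone\<close>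

lemma same_cone_iff:
  fixes s t v w :: real
  assumes st: "0 < s" "s < t" "t < 1"
  shows "0 < (s * w - t * v) * ((1 - t) * v - (1 - s) * w) \<longleftrightarrow>
    0 < v \<and> (1 - t) * v < (1 - s) * w \<and> s * w < t * v \<or>
    0 < - v \<and> (1 - t) * (- v) < (1 - s) * (- w) \<and> s * (- w) < t * (- v)"
proof -
  \<comment> \<open>Eliminating \<open>w\<close> from the two inequalities leaves
    \<open>0 < (t - s) * v\<close>. Thus two negative factors give the chain above
    \<open>pq\<close>, and two positive ones its reflection.\<close>
  have pos: "0 < v" if "(1 - t) * v < (1 - s) * w" "s * w < t * v" for v w
  proof -
    have "s * ((1 - t) * v) < s * ((1 - s) * w)" using that(1) st by (intro mult_strict_left_mono)
    also have "\<dots> = (1 - s) * (s * w)" by simp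
    also have "\<dots> < (1 - s) * (t * v)" using that(2) st by (intro mult_strict_left_mono) auto
    finally have "0 < (t - s) * v" by (simp add: algebra_simps)
    then show ?thesis using st by (simp add: zero_less_mult_iff)
  qed
  from pos[of v w] pos[of "- v" "- w"] show ?thesis
    by (auto simp: zero_less_mult_iff)
qed

text \<open>The rate \<open>c\<close> is 1 in the limit and 1/2 in the dominating function.\<close>

definition cone_density :: "real \<Rightarrow> real \<times> real \<Rightarrow> real \<times> real \<Rightarrow> ennreal" where
  "cone_density c z z' = (if chart_cone z z' then ennreal (exp (- (c * cone_area z z'))) else 0)"

lemma measurable_cone_density [measurable (raw)]:
  assumes "f \<in> borel_measurable M" "g \<in> borel_measurable M"
  shows "(\<lambda>x. cone_density c (f x) (g x)) \<in> borel_measurable M"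
proof -
  note [measurable] = measurable_cone[OF assms] measurable_cone_area[OF assms]
  show ?thesis unfolding cone_density_def by measurable
qed

text \<open>The three configurations exclude each other, so the case distinction becomes a sum that
  can be integrated termwise.\<close>

lemma cone_density_split:
  "cone_density c (s, v) (t, w) =
    (if 0 < s \<and> s < 1 \<and> 0 < t \<and> t < 1
     then (if w < 0 \<and> 0 < v then ennreal (exp (- (c * (v - w)))) else 0) else 0) +
    (if 0 < s \<and> s < t \<and> t < 1
     then (if 0 < v \<and> (1 - t) * v < (1 - s) * w \<and> s * w < t * v
        then ennreal (exp (- (c * (t * v + (1 - s) * w)))) else 0) +
       (if 0 < - v \<and> (1 - t) * (- v) < (1 - s) * (- w) \<and> s * (- w) < t * (- v)
        then ennreal (exp (- (c * (t * (- v) + (1 - s) * (- w))))) else 0) else 0)"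
    (is "_ = (if ?o then (if ?o' then _ else 0) else 0) + (if ?s then (if ?A then _ else 0) + (if ?B then _ else 0) else 0)")
proof -
  have chart_cone: "chart_cone (s, v) (t, w) \<longleftrightarrow> ?o \<and> ?o' \<or> ?s \<and> (?A \<or> ?B)"
    using same_cone_iff[of s t w v] by (auto simp: chart_cone_def)
  have A: "\<not> w < 0 \<and> cone_area (s, v) (t, w) = t * v + (1 - s) * w" if "?s" "?A"
  proof -
    have "0 < (1 - t) * v" using that by simp
    with that have "0 < (1 - s) * w" by linarith
    then have "0 < w" using that by (simp add: zero_less_mult_iff)
    then show ?thesis using that by (simp add: cone_area_def algebra_simps)
  qed
  have B: "\<not> 0 < v \<and> cone_area (s, v) (t, w) = t * (- v) + (1 - s) * (- w)" if "?s" "?B"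
  proof -
    have "0 < (1 - t) * (- v)" using that by (intro mult_pos_pos) auto
    with that have "0 < (1 - s) * (- w)" by linarith
    then have "w < 0" using that by (simp add: mult_less_0_iff)
    then show ?thesis using that by (simp add: cone_area_def algebra_simps)
  qed
  consider "?o" "?o'" | "?s" "?A" | "?s" "?B" | "\<not> chart_cone (s, v) (t, w)" "\<not> (?o \<and> ?o')" "\<not> (?s \<and> ?A)" "\<not> (?s \<and> ?B)"
    using chart_cone by blast
  then show ?thesis
  proof cases
    case 1
    then have "chart_cone (s, v) (t, w)" "\<not> (?s \<and> ?A)" "\<not> (?s \<and> ?B)" "cone_area (s, v) (t, w) = v - w"
      using chart_cone A B by (auto simp: cone_area_def)
    then show ?thesis using 1 by (auto simp: cone_density_def)
  next
    case 2
    then have "chart_cone (s, v) (t, w)" "\<not> ?o'" "\<not> ?B" "cone_area (s, v) (t, w) = t * v + (1 - s) * w"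
      using chart_cone A by auto
    then show ?thesis using 2 by (auto simp: cone_density_def)
  next
    case 3
    then have "chart_cone (s, v) (t, w)" "\<not> ?o'" "\<not> ?A" "cone_area (s, v) (t, w) = t * (- v) + (1 - s) * (- w)"
      using chart_cone B by auto
    then show ?thesis using 3 by (auto simp: cone_density_def)
  next
    case 4
    then show ?thesis by (auto simp: cone_density_def)
  qed
qed

lemma nn_integral2_add:
  fixes f g :: "real \<Rightarrow> real \<Rightarrow> ennreal"
  assumes f: "(\<lambda>(v, w). f v w) \<in> borel_measurable (lborel \<Otimes>\<^sub>M lborel)"
    and g: "(\<lambda>(v, w). g v w) \<in> borel_measurable (lborel \<Otimes>\<^sub>M lborel)"
  shows "(\<integral>\<^sup>+v. \<integral>\<^sup>+w. f v w + g v w \<partial>lborel \<partial>lborel) =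
    (\<integral>\<^sup>+v. \<integral>\<^sup>+w. f v w \<partial>lborel \<partial>lborel) + (\<integral>\<^sup>+v. \<integral>\<^sup>+w. g v w \<partial>lborel \<partial>lborel)"
proof -
  have 1: "f v \<in> borel_measurable lborel" "g v \<in> borel_measurable lborel" for v
    using measurable_Pair2[OF f, of v] measurable_Pair2[OF g, of v] by simp_all
  have 2: "(\<lambda>v. \<integral>\<^sup>+w. f v w \<partial>lborel) \<in> borel_measurable lborel"
    "(\<lambda>v. \<integral>\<^sup>+w. g v w \<partial>lborel) \<in> borel_measurable lborel"
    using lborel.borel_measurable_nn_integral_fst[OF f] lborel.borel_measurable_nn_integral_fst[OF g]
    by simp_all
  show ?thesis
    unfolding nn_integral_add[OF 1] nn_integral_add[OF 2] ..
qed

text \<open>The factor 2 counts chains above and below \<open>pq\<close>;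
  \<open>1 / c\<^sup>2\<close> is the scaling of the two heights.\<close>

lemma cone_density_integral_fibre:
  assumes c: "0 < c"
  shows "(\<integral>\<^sup>+v. \<integral>\<^sup>+w. cone_density c (s, v) (t, w) \<partial>lborel \<partial>lborel) =
    ennreal (1 / c\<^sup>2) * ((if 0 < s \<and> s < 1 \<and> 0 < t \<and> t < 1 then 1 else 0) +
    2 * (if 0 < s \<and> s < t \<and> t < 1 then ennreal ((t - s) / (t * (1 - s))) else 0))"
proof -
  let ?o = "0 < s \<and> s < 1 \<and> 0 < t \<and> t < 1" and ?s = "0 < s \<and> s < t \<and> t < 1"
  let ?O = "\<lambda>v w. (if w < 0 \<and> 0 < v then ennreal (exp (- (c * (v - w)))) else 0)"
  let ?A = "\<lambda>v w. (if 0 < v \<and> (1 - t) * v < (1 - s) * w \<and> s * w < t * v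
    then ennreal (exp (- (c * (t * v + (1 - s) * w)))) else 0)"
  let ?B = "\<lambda>v w. (if 0 < - v \<and> (1 - t) * (- v) < (1 - s) * (- w) \<and> s * (- w) < t * (- v)
    then ennreal (exp (- (c * (t * (- v) + (1 - s) * (- w))))) else 0)"
  have mO: "(\<lambda>(v, w). ?O v w) \<in> borel_measurable (lborel \<Otimes>\<^sub>M lborel)"
    by measurable
  have mA: "(\<lambda>(v, w). ?A v w) \<in> borel_measurable (lborel \<Otimes>\<^sub>M lborel)"
    by measurable
  have mB: "(\<lambda>(v, w). ?B v w) \<in> borel_measurable (lborel \<Otimes>\<^sub>M lborel)"
    by measurable
  have m1: "(\<lambda>(v, w). if ?o then ?O v w else 0) \<in> borel_measurable (lborel \<Otimes>\<^sub>M lborel)"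
  proof (cases ?o)
    case True
    then show ?thesis unfolding if_P[OF True] using mO by simp
  next
    case False
    then show ?thesis unfolding if_not_P[OF False] by simp
  qed
  have m2: "(\<lambda>(v, w). if ?s then ?A v w + ?B v w else 0) \<in> borel_measurable (lborel \<Otimes>\<^sub>M lborel)"
  proof (cases ?s)
    case True
    have "(\<lambda>z. (\<lambda>(v, w). ?A v w) z + (\<lambda>(v, w). ?B v w) z) \<in> borel_measurable (lborel \<Otimes>\<^sub>M lborel)"
      using mA mB by (rule borel_measurable_add)
    then show ?thesis unfolding if_P[OF True] by (simp only: case_prod_beta')
  next
    case False
    then show ?thesis unfolding if_not_P[OF False] by simp
  qed
  have "(\<integral>\<^sup>+v. \<integral>\<^sup>+w. cone_density c (s, v) (t, w) \<partial>lborel \<partial>lborel) =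
      (\<integral>\<^sup>+v. \<integral>\<^sup>+w. (if ?o then ?O v w else 0) \<partial>lborel \<partial>lborel) +
      (\<integral>\<^sup>+v. \<integral>\<^sup>+w. (if ?s then ?A v w + ?B v w else 0) \<partial>lborel \<partial>lborel)"
    unfolding cone_density_split by (rule nn_integral2_add[OF m1 m2])
  also have "(\<integral>\<^sup>+v. \<integral>\<^sup>+w. (if ?o then ?O v w else 0) \<partial>lborel \<partial>lborel) = ennreal (1 / c\<^sup>2) * (if ?o then 1 else 0)"
  proof (cases ?o)
    case True
    show ?thesis unfolding if_P[OF True] by (simp only: opposite_cone_integral[OF c] mult_1_right)
  next
    case False
    show ?thesis unfolding if_not_P[OF False] by simp
  qed
  also have "(\<integral>\<^sup>+v. \<integral>\<^sup>+w. (if ?s then ?A v w + ?B v w else 0) \<partial>lborel \<partial>lborel) =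
      ennreal (1 / c\<^sup>2) * (2 * (if ?s then ennreal ((t - s) / (t * (1 - s))) else 0))"
  proof (cases ?s)
    case True
    have "(\<integral>\<^sup>+v. \<integral>\<^sup>+w. ?A v w + ?B v w \<partial>lborel \<partial>lborel) =
        (\<integral>\<^sup>+v. \<integral>\<^sup>+w. ?A v w \<partial>lborel \<partial>lborel) + (\<integral>\<^sup>+v. \<integral>\<^sup>+w. ?B v w \<partial>lborel \<partial>lborel)"
      by (rule nn_integral2_add[OF mA mB])
    also have "\<dots> = 2 * ennreal ((t - s) / (t * (1 - s)) / c\<^sup>2)"
      using True by (simp only: same_cone_integral[OF c] same_cone_integral_neg[OF c] mult_2)
    also have "\<dots> = ennreal (1 / c\<^sup>2) * (2 * ennreal ((t - s) / (t * (1 - s))))"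
    proof -
      have *: "ennreal (x / c\<^sup>2) = ennreal (1 / c\<^sup>2) * ennreal x" if "0 \<le> x" for x
        using that by (simp flip: ennreal_mult)
      have "0 \<le> (t - s) / (t * (1 - s))" using True by simp
      then show ?thesis by (subst *) (simp_all only: mult.left_commute)
    qed
    finally show ?thesis unfolding if_P[OF True] .
  next
    case False
    show ?thesis unfolding if_not_P[OF False] by simp
  qed
  finally show ?thesis by (simp only: distrib_left)
qed

lemma nn_integral_lborel_prod:
  fixes f :: "'a::euclidean_space \<times> 'b::euclidean_space \<Rightarrow> ennreal"
  assumes "f \<in> borel_measurable borel"
  shows "(\<integral>\<^sup>+z. f z \<partial>lborel) = (\<integral>\<^sup>+a. \<integral>\<^sup>+b. f (a, b) \<partial>lborel \<partial>lborel)"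
  using assms unfolding lborel_prod[symmetric]
  by (intro lborel.nn_integral_fst[symmetric]) (simp add: lborel_prod)

lemma cone_density_integral:
  assumes c: "0 < c"
  shows "(\<integral>\<^sup>+z. \<integral>\<^sup>+z'. cone_density c z z' \<partial>lborel \<partial>lborel) = ennreal ((5 - pi\<^sup>2 / 3) / c\<^sup>2)"
proof -
  let ?o = "\<lambda>(s::real) (t::real). (if 0 < s \<and> s < 1 \<and> 0 < t \<and> t < 1 then 1 else 0 :: ennreal)"
  let ?r = "\<lambda>(s::real) (t::real). (if 0 < s \<and> s < t \<and> t < 1 then ennreal ((t - s) / (t * (1 - s))) else 0)"
  have "(\<integral>\<^sup>+z. \<integral>\<^sup>+z'. cone_density c z z' \<partial>lborel \<partial>lborel)
      = (\<integral>\<^sup>+s. \<integral>\<^sup>+v. \<integral>\<^sup>+z'. cone_density c (s, v) z' \<partial>lborel \<partial>lborel \<partial>lborel)"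
    by (rule nn_integral_lborel_prod) measurable
  also have "\<dots> = (\<integral>\<^sup>+s. \<integral>\<^sup>+v. \<integral>\<^sup>+t. \<integral>\<^sup>+w. cone_density c (s, v) (t, w) \<partial>lborel \<partial>lborel \<partial>lborel \<partial>lborel)"
    by (intro nn_integral_cong nn_integral_lborel_prod) measurable
  \<comment> \<open>Both heights are moved inside, so that the fibre over fixed \<open>s\<close>,
    \<open>t\<close> is integrated first.\<close>
  also have "\<dots> = (\<integral>\<^sup>+s. \<integral>\<^sup>+t. \<integral>\<^sup>+v. \<integral>\<^sup>+w. cone_density c (s, v) (t, w) \<partial>lborel \<partial>lborel \<partial>lborel \<partial>lborel)"
    by (intro nn_integral_cong lborel_pair.Fubini') measurable
  also have "\<dots> = (\<integral>\<^sup>+s. \<integral>\<^sup>+t. ennreal (1 / c\<^sup>2) * (?o s t + 2 * ?r s t) \<partial>lborel \<partial>lborel)"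
    unfolding cone_density_integral_fibre[OF c] ..
  also have "\<dots> = ennreal (1 / c\<^sup>2) * ((\<integral>\<^sup>+s. \<integral>\<^sup>+t. ?o s t \<partial>lborel \<partial>lborel) + 2 * (\<integral>\<^sup>+s. \<integral>\<^sup>+t. ?r s t \<partial>lborel \<partial>lborel))"
    by (simp add: nn_integral_cmult nn_integral_add)
  also have "(\<integral>\<^sup>+s. \<integral>\<^sup>+t. ?o s t \<partial>lborel \<partial>lborel) = 1"
  proof -
    have "?o s t = indicator {0<..<1} s * indicator {0<..<1} t" for s t :: real
      by (auto simp: indicator_def)
    then show ?thesis by (simp add: nn_integral_cmult)
  qed
  also have "(\<integral>\<^sup>+s. \<integral>\<^sup>+t. ?r s t \<partial>lborel \<partial>lborel) = ennreal (2 - pi\<^sup>2 / 6)"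
    by (rule same_cone_density_integral)
  also have "ennreal (1 / c\<^sup>2) * (1 + 2 * ennreal (2 - pi\<^sup>2 / 6)) = ennreal ((5 - pi\<^sup>2 / 3) / c\<^sup>2)"
  proof -
    have *: "ennreal (1 / c\<^sup>2) * (1 + 2 * ennreal x) = ennreal ((1 + 2 * x) / c\<^sup>2)" if "0 \<le> x" for x
    proof -
      have "1 + 2 * ennreal x = ennreal (1 + 2 * x)"
        using that by (simp add: ennreal_plus ennreal_mult)
      show ?thesis
        unfolding \<open>1 + 2 * ennreal x = _\<close> using that by (subst ennreal_mult[symmetric]) auto
    qed
    from *[OF two_minus_pi_nonneg] show ?thesis by simp
  qed
  finally show ?thesis .
qed

section \<open>The limit\<close>

text \<open>The number of points is written as \<open>m + 8\<close>, so that \<open>(m + 4) / (m + 8) \<ge> 1/2\<close> gives an integrable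
  bound that is uniform in \<open>m\<close>.\<close>

lemma power_exp_bound:
  fixes a :: real
  assumes "0 \<le> a"
  shows "ennreal (1 - a / real (m + 8)) ^ (m + 4) \<le> ennreal (exp (- (1 / 2 * a)))"
proof (cases "a \<le> real (m + 8)")
  case True
  then have x: "0 \<le> 1 - a / real (m + 8)" by (simp add: divide_simps)
  have "1 - a / real (m + 8) \<le> exp (- (a / real (m + 8)))"
    using exp_ge_add_one_self[of "- (a / real (m + 8))"] by simp
  then have "(1 - a / real (m + 8)) ^ (m + 4) \<le> exp (- (a / real (m + 8))) ^ (m + 4)"
    using x by (rule power_mono)
  also have "\<dots> = exp (- (real (m + 4) / real (m + 8) * a))"
    by (simp flip: exp_of_nat_mult)
  also have "\<dots> \<le> exp (- (1 / 2 * a))"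
  proof -
    have "1 / 2 \<le> real (m + 4) / real (m + 8)" by (simp add: divide_simps)
    then have "1 / 2 * a \<le> real (m + 4) / real (m + 8) * a" using assms by (rule mult_right_mono)
    then show ?thesis by simp
  qed
  finally show ?thesis using x by (simp add: ennreal_power)
next
  case False
  then have "1 - a / real (m + 8) \<le> 0" by (simp add: divide_simps)
  \<comment> \<open>The truncated base is 0 and the exponent \<open>m + 4\<close> is
    positive.\<close>
  then show ?thesis by (simp add: ennreal_neg zero_power)
qed

text \<open>The exponent is 4 below the denominator; dividing the standard limit by the fourth power
  of the base, which tends to 1, corrects this.\<close>

lemma power_exp_limit:
  fixes a :: real
  shows "(\<lambda>m. ennreal (1 - a / real (m + 8)) ^ (m + 4)) \<longlonglongrightarrow> ennreal (exp (- a))"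
proof -
  let ?x = "\<lambda>m. 1 - a / real (m + 8)"
  have lim1: "?x \<longlonglongrightarrow> 1" by real_asymp
  have "(\<lambda>n. (1 + (- a) / real n) ^ n) \<longlonglongrightarrow> exp (- a)"
    by (rule tendsto_exp_limit_sequentially)
  from LIMSEQ_ignore_initial_segment[OF this, of 8] have "(\<lambda>m. ?x m ^ (m + 8)) \<longlonglongrightarrow> exp (- a)"
    by simp
  from tendsto_divide[OF this tendsto_power[OF lim1, of 4]]
  have "(\<lambda>m. ?x m ^ (m + 8) / ?x m ^ 4) \<longlonglongrightarrow> exp (- a)" by simp
  moreover have ev: "eventually (\<lambda>m. 0 < ?x m) sequentially"
    using lim1 by (rule order_tendstoD) simp
  then have "eventually (\<lambda>m. ?x m ^ (m + 8) / ?x m ^ 4 = ?x m ^ (m + 4)) sequentially"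
  proof eventually_elim
    case (elim m)
    have "m + 8 = (m + 4) + 4" by simp
    then have "?x m ^ (m + 8) = ?x m ^ (m + 4) * ?x m ^ 4" by (simp only: power_add)
    then show ?case using elim by simp
  qed
  ultimately have "(\<lambda>m. ?x m ^ (m + 4)) \<longlonglongrightarrow> exp (- a)"
    by (rule Lim_transform_eventually)
  then have "(\<lambda>m. ennreal (?x m ^ (m + 4))) \<longlonglongrightarrow> ennreal (exp (- a))"
    by (rule tendsto_ennrealI)
  moreover from ev have "eventually (\<lambda>m. ennreal (?x m ^ (m + 4)) = ennreal (?x m) ^ (m + 4)) sequentially"
    by eventually_elim (simp add: ennreal_power)
  ultimately show ?thesis by (rule Lim_transform_eventually)
qed

section \<open>Pointwise limit of the integrand\<close>

lemma chart_tendsto: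
  "(\<lambda>m. chart (real (m + 8)) p q z) \<longlonglongrightarrow> (1 - fst z) *\<^sub>R p + fst z *\<^sub>R q"
proof (rule vec_tendstoI)
  fix i :: 2
  consider "i = 1" | "i = 2" using exhaust_2 by blast
  then show "(\<lambda>m. chart (real (m + 8)) p q z $ i) \<longlonglongrightarrow> ((1 - fst z) *\<^sub>R p + fst z *\<^sub>R q) $ i"
  proof cases
    case 1
    then show ?thesis by (simp add: algebra_simps)
  next
    case 2
    have "(\<lambda>m. 2 / (q$1 - p$1) * snd z / real (m + 8)) \<longlonglongrightarrow> 0" by real_asymp
    from tendsto_add[OF tendsto_const[of "p$2 + (q$2 - p$2) * fst z"] this]
    show ?thesis using 2 by (simp add: algebra_simps)
  qed
qed

text \<open>This is where \<open>K\<close> drops out of the limit. Interior points are required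
  since a limit on the boundary could be approached from outside.\<close>

lemma chart_eventually_in:
  assumes "convex K" "p \<in> interior K" "q \<in> interior K" "0 < fst z" "fst z < 1"
  shows "eventually (\<lambda>m. chart (real (m + 8)) p q z \<in> K) sequentially"
proof -
  have "(1 - fst z) *\<^sub>R p + fst z *\<^sub>R q \<in> interior K"
    using convex_interior[OF assms(1)] assms by (auto simp: convex_alt)
  from topological_tendstoD[OF chart_tendsto open_interior this]
  show ?thesis by eventually_elim (use interior_subset in blast)
qed

lemma cone_less:
  assumes "chart_cone z z'"
  shows "0 < fst z \<and> fst z < 1 \<and> 0 < fst z' \<and> fst z' < 1"
  using assms by (auto simp: chart_cone_def)

section \<open>Dominated convergence, for the middle points and then for the extreme ones\<close>

context
  fixes K :: "(real^2) set" and U :: "(real^2) measure"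
  assumes K_sets [measurable]: "K \<in> sets borel" and K_measure: "emeasure lborel K = 1"
    and U_def: "U = uniform_measure lborel K" and K_convex: "convex K"
begin

abbreviation chart_density :: "nat \<Rightarrow> real^2 \<Rightarrow> real^2 \<Rightarrow> real \<times> real \<Rightarrow> real \<times> real \<Rightarrow> ennreal" where
  "chart_density m p q z z' \<equiv> (if chart_cone z z' \<and> chart (real (m + 8)) p q z \<in> K \<and> chart (real (m + 8)) p q z' \<in> K
      then ennreal (1 - cone_area z z' / real (m + 8)) ^ (m + 4) else 0)"

lemma chart_density_le: "chart_density m p q z z' \<le> cone_density (1 / 2) z z'"
  using power_exp_bound[OF cone_area_nonneg, of z z' m] by (simp add: cone_density_def)

lemma chart_density_tendsto:
  assumes "p \<in> interior K" "q \<in> interior K"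
  shows "(\<lambda>m. chart_density m p q z z') \<longlonglongrightarrow> cone_density 1 z z'"
proof (cases "chart_cone z z'")
  case True
  have "eventually (\<lambda>m. ennreal (1 - cone_area z z' / real (m + 8)) ^ (m + 4) = chart_density m p q z z') sequentially"
    using chart_eventually_in[OF K_convex assms, of z] chart_eventually_in[OF K_convex assms, of z']
      cone_less[OF True] True by (auto elim: eventually_elim2)
  from Lim_transform_eventually[OF power_exp_limit this] show ?thesis
    using True by (simp add: cone_density_def)
qed (simp add: cone_density_def)

lemma measurable_chart_density:
  "(\<lambda>x. chart_density m p q (fst x) (snd x)) \<in> borel_measurable (lborel \<Otimes>\<^sub>M lborel)"
  by measurable

text \<open>The factor 4 is \<open>1 / c\<^sup>2\<close> at rate 1/2. The bound is uniform in
  \<open>p\<close> and \<open>q\<close> and dominates the outer integral.\<close>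

lemma chart_integral_le:
  "chart_integral K (real (m + 8)) (m + 4) p q \<le> ennreal (4 * (5 - pi\<^sup>2 / 3))"
proof -
  have "chart_integral K (real (m + 8)) (m + 4) p q \<le> (\<integral>\<^sup>+z. \<integral>\<^sup>+z'. cone_density (1 / 2) z z' \<partial>lborel \<partial>lborel)"
    unfolding chart_integral_def by (intro nn_integral_mono chart_density_le)
  also have "\<dots> = ennreal (4 * (5 - pi\<^sup>2 / 3))"
  proof -
    have "x / (1 / 2)\<^sup>2 = 4 * x" for x :: real by (simp add: power2_eq_square)
    then show ?thesis by (subst cone_density_integral) (simp_all only: zero_less_divide_1_iff zero_less_numeral)
  qed
  finally show ?thesis .
qed

lemma chart_integral_tendsto:
  assumes "p \<in> interior K" "q \<in> interior K"
  shows "(\<lambda>m. chart_integral K (real (m + 8)) (m + 4) p q) \<longlonglongrightarrow> ennreal (5 - pi\<^sup>2 / 3)"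
proof -
  let ?M = "lborel \<Otimes>\<^sub>M lborel :: ((real \<times> real) \<times> (real \<times> real)) measure"
  have meas: "(\<lambda>x. cone_density c (fst x) (snd x)) \<in> borel_measurable ?M" for c
    by measurable
  have fst: "(\<integral>\<^sup>+x. f (fst x) (snd x) \<partial>?M) = (\<integral>\<^sup>+z. \<integral>\<^sup>+z'. f z z' \<partial>lborel \<partial>lborel)"
    if "(\<lambda>x. f (fst x) (snd x)) \<in> borel_measurable ?M" for f :: "real \<times> real \<Rightarrow> real \<times> real \<Rightarrow> ennreal"
    using lborel.nn_integral_fst[OF that] unfolding fst_conv snd_conv by (rule sym)
  have "(\<lambda>m. \<integral>\<^sup>+x. chart_density m p q (fst x) (snd x) \<partial>?M) \<longlonglongrightarrow> (\<integral>\<^sup>+x. cone_density 1 (fst x) (snd x) \<partial>?M)"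
  proof (rule nn_integral_dominated_convergence[where w="\<lambda>x. cone_density (1 / 2) (fst x) (snd x)"])
    show "(\<integral>\<^sup>+x. cone_density (1 / 2) (fst x) (snd x) \<partial>?M) < \<infinity>"
      unfolding fst[OF meas] by (subst cone_density_integral) simp_all
    show "AE x in ?M. chart_density m p q (fst x) (snd x) \<le> cone_density (1 / 2) (fst x) (snd x)" for m
      by (intro AE_I2 chart_density_le)
    show "AE x in ?M. (\<lambda>m. chart_density m p q (fst x) (snd x)) \<longlonglongrightarrow> cone_density 1 (fst x) (snd x)"
      by (intro AE_I2 chart_density_tendsto assms)
  qed (rule measurable_chart_density meas)+
  then show ?thesis
    unfolding fst[OF meas] fst[OF measurable_chart_density] chart_integral_def[symmetric]
    by (subst (asm) cone_density_integral) simp_all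
qed

text \<open>The frontier of a convex set is a null set.\<close>

lemma AE_U_interior: "AE x in U. x \<in> interior K"
proof -
  have "frontier K \<in> null_sets lborel"
    using negligible_convex_frontier[OF K_convex]
    by (simp add: negligible_iff_null_sets null_sets_completion_iff)
  then have "AE x in lborel. x \<notin> frontier K" by (rule AE_not_in)
  then have "AE x in U. x \<notin> frontier K" by (rule AE_U[OF K_sets K_measure U_def])
  with AE_U_K[OF K_sets K_measure U_def K_convex] show ?thesis
    by eventually_elim (use closure_subset in \<open>auto simp: frontier_def\<close>)
qed

text \<open>Exchanging the two points preserves the product measure, and ties have probability
  0.\<close>

lemma prob_left_of_half:
  "(\<integral>\<^sup>+x. (if fst x $ 1 < snd x $ 1 then 1 else 0) \<partial>(U \<Otimes>\<^sub>M U)) = ennreal (1 / 2)"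
proof -
  interpret prob_space U by (rule prob_space_U[OF K_sets K_measure U_def])
  interpret UU: pair_prob_space U U ..
  have sU [measurable_cong]: "sets U = sets borel" by (simp add: U_def)
  let ?f = "\<lambda>p q :: real^2. (if p$1 < q$1 then 1 else 0 :: ennreal)"
  have m: "(\<lambda>x. ?f (fst x) (snd x)) \<in> borel_measurable (U \<Otimes>\<^sub>M U)" by measurable
  have m': "(\<lambda>x. ?f (snd x) (fst x)) \<in> borel_measurable (U \<Otimes>\<^sub>M U)" by measurable
  let ?H = "\<integral>\<^sup>+x. ?f (fst x) (snd x) \<partial>(U \<Otimes>\<^sub>M U)"
  have H: "?H = (\<integral>\<^sup>+p. \<integral>\<^sup>+q. ?f p q \<partial>U \<partial>U)"
    using nn_integral_fst[OF m] by simp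
  have "(\<integral>\<^sup>+p. \<integral>\<^sup>+q. ?f p q \<partial>U \<partial>U) = (\<integral>\<^sup>+q. \<integral>\<^sup>+p. ?f p q \<partial>U \<partial>U)"
    using m by (intro UU.Fubini'[symmetric]) (simp add: case_prod_beta')
  also have "\<dots> = (\<integral>\<^sup>+x. ?f (snd x) (fst x) \<partial>(U \<Otimes>\<^sub>M U))"
    using nn_integral_fst[OF m'] by simp
  finally have H': "?H = (\<integral>\<^sup>+x. ?f (snd x) (fst x) \<partial>(U \<Otimes>\<^sub>M U))" using H by simp
  have "AE x in U \<Otimes>\<^sub>M U. fst x $ 1 \<noteq> snd x $ 1"
  proof (rule UU.AE_pair_measure)
    show "AE p in U. AE q in U. fst (p, q) $ 1 \<noteq> snd (p, q) $ 1"
      using AE_U[OF K_sets K_measure U_def AE_lborel_nth_neq] by (auto simp: eq_commute)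
  qed measurable
  then have "AE x in U \<Otimes>\<^sub>M U. ?f (fst x) (snd x) + ?f (snd x) (fst x) = 1"
    by eventually_elim auto
  then have "(\<integral>\<^sup>+x. ?f (fst x) (snd x) + ?f (snd x) (fst x) \<partial>(U \<Otimes>\<^sub>M U)) = (\<integral>\<^sup>+x. 1 \<partial>(U \<Otimes>\<^sub>M U))"
    by (rule nn_integral_cong_AE)
  also have "\<dots> = 1" using UU.emeasure_space_1 by simp
  finally have "?H + ?H = 1"
    using nn_integral_add[OF m m'] H' by simp
  obtain r where r: "?H = ennreal r" "0 \<le> r"
    using \<open>?H + ?H = 1\<close> by (cases ?H rule: ennreal_cases) auto
  with \<open>?H + ?H = 1\<close> have "ennreal (r + r) = ennreal 1" by (simp only: ennreal_plus ennreal_1)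
  then have "r + r = 1" using r(2) by (subst (asm) ennreal_inj) auto
  then show ?thesis unfolding r(1) by (intro arg_cong[where f=ennreal]) simp
qed

text \<open>The prefactor cancels the Jacobian \<open>4 / r\<^sup>2\<close> at
  \<open>r = m + 8\<close>.\<close>

lemma empty_quad_integral_tendsto:
  "(\<lambda>m. ennreal (real (m + 8) ^ 2 / 4) * empty_quad_integral U (m + 4)) \<longlonglongrightarrow> ennreal ((5 - pi\<^sup>2 / 3) / 2)"
proof -
  interpret prob_space U by (rule prob_space_U[OF K_sets K_measure U_def])
  interpret UU: pair_prob_space U U ..
  have sU [measurable_cong]: "sets U = sets borel" by (simp add: U_def)
  let ?J = "\<lambda>m x. if fst x $ 1 < snd x $ 1
    then chart_integral K (real (m + 8)) (m + 4) (fst x) (snd x) else 0"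
  let ?l = "\<lambda>x :: (real^2) \<times> (real^2). if fst x $ 1 < snd x $ 1 then ennreal (5 - pi\<^sup>2 / 3) else 0"
  have mJ: "?J m \<in> borel_measurable (U \<Otimes>\<^sub>M U)" for m
  proof -
    have [measurable]: "(\<lambda>x. chart_integral K (real (m + 8)) (m + 4) (fst x) (snd x)) \<in> borel_measurable (U \<Otimes>\<^sub>M U)"
      using measurable_chart_integral[OF K_sets K_measure U_def K_convex]
      by (simp add: measurable_cong_sets[OF sets_pair_measure_cong[OF sU sU] refl])
    show ?thesis by measurable
  qed
  have eq: "ennreal (real (m + 8) ^ 2 / 4) * empty_quad_integral U (m + 4) = (\<integral>\<^sup>+x. ?J m x \<partial>(U \<Otimes>\<^sub>M U))" for m
  proof -
    have "ennreal (real (m + 8) ^ 2 / 4) * ennreal (4 / (real (m + 8))\<^sup>2) = 1"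
      by (subst ennreal_mult[symmetric]) auto
    then show ?thesis
      using empty_quad_integral_eq_chart_integral[OF K_sets K_measure U_def K_convex, of "real (m + 8)" "m + 4"]
      by (simp add: mult.assoc[symmetric])
  qed
  have "(\<lambda>m. \<integral>\<^sup>+x. ?J m x \<partial>(U \<Otimes>\<^sub>M U)) \<longlonglongrightarrow> (\<integral>\<^sup>+x. ?l x \<partial>(U \<Otimes>\<^sub>M U))"
  proof (rule nn_integral_dominated_convergence[where w="\<lambda>_. ennreal (4 * (5 - pi\<^sup>2 / 3))"])
    show "AE x in U \<Otimes>\<^sub>M U. ?J m x \<le> ennreal (4 * (5 - pi\<^sup>2 / 3))" for m
      using chart_integral_le by (intro AE_I2) auto
    show "(\<integral>\<^sup>+x. ennreal (4 * (5 - pi\<^sup>2 / 3)) \<partial>(U \<Otimes>\<^sub>M U)) < \<infinity>"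
      using UU.emeasure_space_1 by simp
    have [measurable]: "interior K \<in> sets borel" by simp
    have "AE x in U \<Otimes>\<^sub>M U. fst x \<in> interior K \<and> snd x \<in> interior K"
    proof (rule UU.AE_pair_measure)
      show "AE p in U. AE q in U. fst (p, q) \<in> interior K \<and> snd (p, q) \<in> interior K"
        using AE_U_interior
      proof eventually_elim
        case (elim p)
        from AE_U_interior show ?case by eventually_elim (use elim in simp)
      qed
    qed measurable
    then show "AE x in U \<Otimes>\<^sub>M U. (\<lambda>m. ?J m x) \<longlonglongrightarrow> ?l x"
    proof eventually_elim
      case (elim x)
      show ?case
      proof (cases "fst x $ 1 < snd x $ 1")
        case True
        show ?thesis unfolding if_P[OF True] using elim by (intro chart_integral_tendsto) auto
      next
        case False
        show ?thesis unfolding if_not_P[OF False] by simp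
      qed
    qed
  qed (use mJ in measurable)
  also have "(\<integral>\<^sup>+x. ?l x \<partial>(U \<Otimes>\<^sub>M U)) = ennreal ((5 - pi\<^sup>2 / 3) / 2)"
  proof -
    have "(\<integral>\<^sup>+x. ?l x \<partial>(U \<Otimes>\<^sub>M U)) =
        (\<integral>\<^sup>+x. ennreal (5 - pi\<^sup>2 / 3) * (if fst x $ 1 < snd x $ 1 then 1 else 0) \<partial>(U \<Otimes>\<^sub>M U))"
      by (intro nn_integral_cong) auto
    also have "\<dots> = ennreal (5 - pi\<^sup>2 / 3) * ennreal (1 / 2)"
      by (subst nn_integral_cmult, measurable) (simp only: prob_left_of_half)
    also have "\<dots> = ennreal ((5 - pi\<^sup>2 / 3) * (1 / 2))"
      by (rule ennreal_mult''[symmetric]) simp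
    finally show ?thesis by (simp only: mult_1_right times_divide_eq_right)
  qed
  finally show ?thesis unfolding eq .
qed

end

theorem theorem6:
  fixes K :: "(real^2) set"
  assumes "convex_body K"
    and "measure lborel K = 1"
  shows "(\<lambda>n. expected_holes 4 K n / (real n)\<^sup>2) \<longlonglongrightarrow> 10 - 2 * pi\<^sup>2 / 3"
proof -
  define U where "U = uniform_measure lborel K"
  have K: "compact K" "convex K" using assms(1) by (auto simp: convex_body_def)
  then have K_sets: "K \<in> sets borel" by (simp add: borel_compact)
  have K_measure: "emeasure lborel K = 1"
    using emeasure_eq_ennreal_measure[of lborel K] emeasure_compact_finite[OF K(1)] assms(2) by simp
  let ?I = "\<lambda>m. enn2real (ennreal (real (m + 8) ^ 2 / 4) * empty_quad_integral U (m + 4))"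
  \<comment> \<open>What remains of n (n-1) (n-2) (n-3) for n = m + 8 after division by n^2 and by
    the factor n^2/4 contained in \<open>?I\<close>.\<close>
  let ?c = "\<lambda>m. real (m + 7) * real (m + 6) * real (m + 5) / real (m + 8) ^ 3 * 4"
  have I: "?I \<longlonglongrightarrow> (5 - pi\<^sup>2 / 3) / 2"
    using empty_quad_integral_tendsto[OF K_sets K_measure U_def K(2)] two_minus_pi_nonneg
    by (intro tendsto_enn2real) auto
  have c: "?c \<longlonglongrightarrow> 4" by real_asymp
  have "expected_holes 4 K (m + 8) / (real (m + 8))\<^sup>2 = ?c m * ?I m" for m
  proof -
    define r x y z e where "r = real (m + 8)" and "x = real (m + 7)" and "y = real (m + 6)"
      and "z = real (m + 5)" and "e = enn2real (empty_quad_integral U (m + 4))"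
    note d = this
    have "expected_holes 4 K (m + 8) = r * x * y * z * e"
    proof -
      have "m + 8 - 1 = m + 7" "m + 8 - 2 = m + 6" "m + 8 - 3 = m + 5" "m + 8 - 4 = m + 4" by simp_all
      then show ?thesis by (simp only: expected_holes_eq[OF K_sets K_measure U_def] of_nat_mult d)
    qed
    moreover have "?I m = r\<^sup>2 / 4 * e" by (simp add: enn2real_mult d)
    moreover have "0 < r" by (simp add: d)
    ultimately show ?thesis
      unfolding d(1-4)[symmetric] by (simp add: field_simps power2_eq_square power3_eq_cube)
  qed
  with tendsto_mult[OF c I] have "(\<lambda>m. expected_holes 4 K (m + 8) / (real (m + 8))\<^sup>2) \<longlonglongrightarrow> 4 * ((5 - pi\<^sup>2 / 3) / 2)"
    by simp
  then have "(\<lambda>n. expected_holes 4 K n / (real n)\<^sup>2) \<longlonglongrightarrow> 4 * ((5 - pi\<^sup>2 / 3) / 2)"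
    by (rule LIMSEQ_offset)
  moreover have "4 * ((5 - pi\<^sup>2 / 3) / 2) = 10 - 2 * pi\<^sup>2 / 3" by (simp add: field_simps)
  ultimately show ?thesis by (simp only:)
qed

end
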